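(* The space $\mathfrak{B}$ is invariant under the Poisson bracket $\{\cdot,\cdot\}$, and the linear map $\Psi:\mathfrak{B}\to\mathscr{B}$ defined by $\Psi(\mathfrak{b}^l_{i,k})={\rm B}^l_{i,k}$ is a Lie isomorphism from $(\mathfrak{B},\{\cdot,\cdot\})$ onto $(\mathscr{B},[\cdot,\cdot])$.
   Context: Work over $\mathbb{R}$ with coordinates $(x,y,z)$ and $\Delta:=xz-y^2$. Vector fields (with polynomial or formal power series coefficients) are identified with derivations, with bracket $[v,w]=vw-wv$ and ${\rm ad}_v w=[v,w]$. Let ${\rm N}=x\frac{\partial}{\partial y}+2y\frac{\partial}{\partial z}$, ${\rm M}=z\frac{\partial}{\partial y}+2y\frac{\partial}{\partial x}$, and $\kappa_{l,m}:=\frac{m!}{(m-l)!}$. For integers $i,k\ge 0$, $-1\le l\le 2i+1$, define $${\rm B}^l_{i,k}:=\frac{{\rm ad}_{\rm N}^{\,l+1}(z^i\Delta^k{\rm M})}{\kappa_{l+1,2i+2}}.$$ In particular ${\rm B}^1_{0,0}=-{\rm N}$. The space $\mathscr{B}$ consists of all formal vector fields $c\,{\rm B}^1_{0,0}+\sum b^l_{i,k}{\rm B}^l_{i,k}$ with $c,b^l_{i,k}\in\mathbb R$, the (possibly infinite) sum being over $i,k\ge0$ with $i+2k\ge1$ and $-1\le l\le 2i+1$. On $\mathbb{R}[[x,y,z]]$ let $\{\cdot,\cdot\}$ be the Poisson bracket determined by $\{x,y\}=x$, $\{x,z\}=2y$, $\{y,z\}=z$, bilinearity, antisymmetry and the Leibniz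 rule. With ${\rm ad}_x f=\{x,f\}$, set for $i,k\ge0$, $-1\le l\le 2i+1$ $$\mathfrak{b}^l_{i,k}:=-\frac{{\rm ad}_x^{\,l+1}(z^{i+1}\Delta^k)}{(i+1)\kappa_{l+1,2i+2}}.$$ $\mathfrak{B}$ is the space of all formal series $c\,\mathfrak{b}^1_{0,0}+\sum\beta^l_{i,k}\mathfrak{b}^l_{i,k}$ with $c,\beta^l_{i,k}\in\mathbb R$, over the same index set ($i,k\ge0$, $i+2k\ge1$, $-1\le l\le 2i+1$). $\Psi$ is extended to formal series linearly (term by term). *)

theory Defs
  imports
    "HOL-Computational_Algebra.Formal_Power_Series"
    "HOL-Library.Product_Plus"
begin

section \<open>The ring of formal power series in x, y, z\<close>

text \<open>The ring R[[x,y,z]] is realised as R[[x]][[y]][[z]]; the outermost variable is z.\<close>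

type_synonym series = "real fps fps fps"

definition coeff3 :: "series \<Rightarrow> nat \<Rightarrow> nat \<Rightarrow> nat \<Rightarrow> real" where
  "coeff3 f a b c = fps_nth (fps_nth (fps_nth f c) b) a"

definition const3 :: "real \<Rightarrow> series" where
  "const3 r = fps_const (fps_const (fps_const r))"

definition varx :: series where "varx = fps_const (fps_const fps_X)"
definition vary :: series where "vary = fps_const fps_X"
definition varz :: series where "varz = fps_X"

definition Delta :: series where "Delta = varx * varz - vary ^ 2"

definition sscale :: "real \<Rightarrow> series \<Rightarrow> series" where
  "sscale r f = const3 r * f"

definition map_coeffs :: "('a::zero \<Rightarrow> 'a) \<Rightarrow> 'a fps \<Rightarrow> 'a fps" where
  "map_coeffs D f = Abs_fps (\<lambda>n. D (fps_nth f n))"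

definition dx :: "series \<Rightarrow> series" where "dx = map_coeffs (map_coeffs fps_deriv)"
definition dy :: "series \<Rightarrow> series" where "dy = map_coeffs fps_deriv"
definition dz :: "series \<Rightarrow> series" where "dz = fps_deriv"

lemma series_eqI: "(\<And>a b c. coeff3 f a b c = coeff3 g a b c) \<Longrightarrow> f = g"
  by (simp add: coeff3_def fps_eq_iff)

lemma coeff3_simps [simp]:
  "coeff3 (f + g) a b c = coeff3 f a b c + coeff3 g a b c"
  "coeff3 (f - g) a b c = coeff3 f a b c - coeff3 g a b c"
  "coeff3 (- f) a b c = - coeff3 f a b c"
  "coeff3 0 a b c = 0"
  "coeff3 (sscale r f) a b c = r * coeff3 f a b c"
  "coeff3 (const3 r) a b c = (if a = 0 \<and> b = 0 \<and> c = 0 then r else 0)"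
  by (simp_all add: coeff3_def sscale_def const3_def)

lemma coeff3_mult:
  "coeff3 (f * g) a b c =
    (\<Sum>k=0..c. \<Sum>j=0..b. \<Sum>i=0..a. coeff3 f i j k * coeff3 g (a - i) (b - j) (c - k))"
  by (simp add: coeff3_def fps_mult_nth fps_sum_nth)

lemma coeff3_d:
  "coeff3 (dx f) a b c = (real a + 1) * coeff3 f (Suc a) b c"
  "coeff3 (dy f) a b c = (real b + 1) * coeff3 f a (Suc b) c"
  "coeff3 (dz f) a b c = (real c + 1) * coeff3 f a b (Suc c)"
proof -
  have of_nat1: "(of_nat n :: real fps) = fps_const (of_nat n)" for n
    by (simp add: fps_of_nat)
  have of_nat2: "(of_nat n :: real fps fps) = fps_const (fps_const (of_nat n))" for n
    by (simp add: fps_of_nat)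
  show "coeff3 (dx f) a b c = (real a + 1) * coeff3 f (Suc a) b c"
    by (simp add: coeff3_def dx_def map_coeffs_def)
  show "coeff3 (dy f) a b c = (real b + 1) * coeff3 f a (Suc b) c"
    using of_nat1[of "Suc b"] by (simp add: coeff3_def dy_def map_coeffs_def)
  show "coeff3 (dz f) a b c = (real c + 1) * coeff3 f a b (Suc c)"
    using of_nat2[of "Suc c"] by (simp add: coeff3_def dz_def)
qed

lemma d_const [simp]: "dx (const3 r) = 0" "dy (const3 r) = 0" "dz (const3 r) = 0"
  by (auto intro!: series_eqI simp: coeff3_d)

lemma d_add [simp]:
  "dx (f + g) = dx f + dx g" "dy (f + g) = dy f + dy g" "dz (f + g) = dz f + dz g"
  by (auto intro!: series_eqI simp: coeff3_d algebra_simps)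

lemma map_coeffs_mult:
  fixes D :: "'a::comm_ring_1 \<Rightarrow> 'a"
  assumes add: "\<And>p q. D (p + q) = D p + D q"
    and mult: "\<And>p q. D (p * q) = D p * q + p * D q"
  shows "map_coeffs D (f * g) = map_coeffs D f * g + f * map_coeffs D g"
proof -
  have "D (0 + 0) = D 0 + D 0" by (rule add)
  hence D0: "D 0 = 0" by simp
  have Dsum: "D (sum h A) = (\<Sum>i\<in>A. D (h i))" if "finite A" for h and A :: "nat set"
    using that by (induction A rule: finite_induct) (simp_all add: D0 add)
  show ?thesis
    by (rule fps_ext) (simp add: map_coeffs_def fps_mult_nth Dsum mult sum.distrib)
qed

lemma map_coeffs_add:
  assumes add: "\<And>p q. D (p + q) = D p + D (q :: 'a::comm_ring_1)"
  shows "map_coeffs D (f + g) = map_coeffs D f + map_coeffs D g"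
  by (rule fps_ext) (simp add: map_coeffs_def add)

lemma d_mult:
  "dx (f * g) = dx f * g + f * dx g"
  "dy (f * g) = dy f * g + f * dy g"
  "dz (f * g) = dz f * g + f * dz g"
proof -
  have dmap: "map_coeffs fps_deriv (f * g) = map_coeffs fps_deriv f * g + f * map_coeffs fps_deriv g"
    for f g :: "'a::comm_ring_1 fps fps"
    by (rule map_coeffs_mult) (simp_all add: algebra_simps)
  show "dy (f * g) = dy f * g + f * dy g"
    unfolding dy_def by (rule dmap)
  show "dx (f * g) = dx f * g + f * dx g"
    unfolding dx_def
    by (rule map_coeffs_mult) (simp_all add: dmap map_coeffs_add)
  show "dz (f * g) = dz f * g + f * dz g"
    by (simp add: dz_def algebra_simps)
qed

lemma coeff3_1: "coeff3 1 a b c = (if a = 0 \<and> b = 0 \<and> c = 0 then 1 else 0)"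
  by (simp add: coeff3_def)

lemma coeff3_vars:
  "coeff3 varx a b c = (if a = 1 \<and> b = 0 \<and> c = 0 then 1 else 0)"
  "coeff3 vary a b c = (if a = 0 \<and> b = 1 \<and> c = 0 then 1 else 0)"
  "coeff3 varz a b c = (if a = 0 \<and> b = 0 \<and> c = 1 then 1 else 0)"
  by (auto simp: coeff3_def varx_def vary_def varz_def)

lemma d_vars [simp]:
  "dx varx = 1" "dx vary = 0" "dx varz = 0"
  "dy varx = 0" "dy vary = 1" "dy varz = 0"
  "dz varx = 0" "dz vary = 0" "dz varz = 1"
  by (auto intro!: series_eqI simp: coeff3_d coeff3_vars coeff3_1)

lemma d_sscale [simp]:
  "dx (sscale r f) = sscale r (dx f)"
  "dy (sscale r f) = sscale r (dy f)"
  "dz (sscale r f) = sscale r (dz f)"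
  by (simp_all add: sscale_def d_mult)


lemma sscale_diff: "sscale r (f - g) = sscale r f - sscale r g"
  by (simp add: sscale_def algebra_simps)

lemma const3_eq [simp]: "const3 0 = 0" "const3 1 = 1" "const3 (numeral n) = numeral n"
  by (simp_all add: const3_def numeral_fps_const)

lemma d_0 [simp]: "dx 0 = 0" "dy 0 = 0" "dz 0 = 0"
  and d_1 [simp]: "dx 1 = 0" "dy 1 = 0" "dz 1 = 0"
  using d_const[of 0] d_const[of 1] by simp_all

lemma d_diff [simp]:
  "dx (f - g) = dx f - dx g" "dy (f - g) = dy f - dy g" "dz (f - g) = dz f - dz g"
  by (auto intro!: series_eqI simp: coeff3_d algebra_simps)

lemma d_uminus [simp]: "dx (- f) = - dx f" "dy (- f) = - dy f" "dz (- f) = - dz f"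
  using d_diff[of 0 f] by simp_all

lemma d_numeral [simp]: "dx (numeral n) = 0" "dy (numeral n) = 0" "dz (numeral n) = 0"
  using d_const[of "numeral n"] by simp_all


section \<open>Formal vector fields as derivations\<close>

text \<open>The triple (u, v, w) stands for the vector field u d/dx + v d/dy + w d/dz.\<close>

type_synonym vfield = "series \<times> series \<times> series"

fun vf_apply :: "vfield \<Rightarrow> series \<Rightarrow> series" where
  "vf_apply (u, v, w) f = u * dx f + v * dy f + w * dz f"

fun vf_times :: "series \<Rightarrow> vfield \<Rightarrow> vfield" where
  "vf_times g (u, v, w) = (g * u, g * v, g * w)"

definition vscale :: "real \<Rightarrow> vfield \<Rightarrow> vfield" where
  "vscale r v = vf_times (const3 r) v"

definition is_derivation :: "(series \<Rightarrow> series) \<Rightarrow> bool" where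
  "is_derivation D \<longleftrightarrow>
    (\<forall>f g. D (f + g) = D f + D g) \<and>
    (\<forall>r f. D (sscale r f) = sscale r (D f)) \<and>
    (\<forall>f g. D (f * g) = D f * g + f * D g)"

text \<open>A derivation is determined by its values on the coordinates, hence is a vector field
  (see \<open>vf_apply_vf_of\<close> below).\<close>

definition vf_of :: "(series \<Rightarrow> series) \<Rightarrow> vfield" where
  "vf_of D = (D varx, D vary, D varz)"

definition lie_bracket :: "vfield \<Rightarrow> vfield \<Rightarrow> vfield" where
  "lie_bracket v w = vf_of (\<lambda>f. vf_apply v (vf_apply w f) - vf_apply w (vf_apply v f))"

lemma series_decomp:
  "\<exists>r p q s. f = const3 r + varx * p + vary * q + varz * s"
proof -
  have fps_dec: "\<exists>s. h = fps_const (fps_nth h 0) + fps_X * s" for h :: "'a::comm_ring_1 fps"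
  proof
    have "fps_X * fps_shift 1 h + fps_cutoff 1 h = h"
      by (simp add: fps_eq_iff)
    moreover have "fps_cutoff 1 h = fps_const (fps_nth h 0)"
      by (simp add: fps_eq_iff)
    ultimately show "h = fps_const (fps_nth h 0) + fps_X * fps_shift 1 h"
      by (simp add: add.commute)
  qed
  obtain s where s: "f = fps_const (fps_nth f 0) + fps_X * s" using fps_dec by blast
  obtain q where q: "fps_nth f 0 = fps_const (fps_nth (fps_nth f 0) 0) + fps_X * q"
    using fps_dec by blast
  obtain p where p: "fps_nth (fps_nth f 0) 0 =
      fps_const (fps_nth (fps_nth (fps_nth f 0) 0) 0) + fps_X * p"
    using fps_dec by blast
  have "f = const3 (fps_nth (fps_nth (fps_nth f 0) 0) 0) + varx * fps_const (fps_const p)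
      + vary * fps_const q + varz * s"
    unfolding const3_def varx_def vary_def varz_def
    by (subst s, subst q, subst p) (simp flip: fps_const_add fps_const_mult)
  thus ?thesis by blast
qed

lemma derivation_eqI:
  assumes D: "is_derivation D" and E: "is_derivation E"
    and xyz: "D varx = E varx" "D vary = E vary" "D varz = E varz"
  shows "D = E"
proof
  fix f
  define F where "F g = D g - E g" for g
  have F: "is_derivation F"
    using D E by (simp add: is_derivation_def F_def sscale_diff algebra_simps)
  have Fxyz: "F varx = 0" "F vary = 0" "F varz = 0"
    using xyz by (simp_all add: F_def)
  have add: "F (g + h) = F g + F h" and mult: "F (g * h) = F g * h + g * F h"
    and scale: "F (sscale r g) = sscale r (F g)" for g h r
    using F by (auto simp: is_derivation_def)
  have "F 1 = 0" using mult[of 1 1] by simp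
  hence const: "F (const3 r) = 0" for r
    using scale[of r 1] by (simp add: sscale_def)
  have "\<forall>g a b c. a + b + c < n \<longrightarrow> coeff3 (F g) a b c = 0" for n
  proof (induction n)
    case (Suc n)
    have step: "coeff3 (varx * h) a b c = 0" "coeff3 (vary * h) a b c = 0"
        "coeff3 (varz * h) a b c = 0"
      if h: "\<forall>a b c. a + b + c < n \<longrightarrow> coeff3 h a b c = 0" and "a + b + c < Suc n" for h a b c
      using that by (auto simp: coeff3_def varx_def vary_def varz_def)
    show ?case
    proof (intro allI impI)
      fix g a b c assume lt: "a + b + c < Suc n"
      obtain r p q s where g: "g = const3 r + varx * p + vary * q + varz * s"
        using series_decomp by blast
      have "F g = varx * F p + vary * F q + varz * F s"
        by (simp add: g add mult const Fxyz)
      thus "coeff3 (F g) a b c = 0"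
        using Suc.IH lt by (simp add: step)
    qed
  qed simp
  hence "F f = 0" by (intro series_eqI) (metis coeff3_simps(4) lessI)
  thus "D f = E f" by (simp add: F_def)
qed

lemma is_derivation_vf_apply: "is_derivation (vf_apply v)"
  by (cases v) (simp add: is_derivation_def d_mult sscale_def algebra_simps)

lemma vf_apply_vf_of: "is_derivation D \<Longrightarrow> vf_apply (vf_of D) = D"
  by (rule derivation_eqI) (simp_all add: is_derivation_vf_apply vf_of_def)

lemma vf_of_vf_apply: "vf_of (vf_apply v) = v"
  by (cases v) (simp add: vf_of_def)

lemma is_derivation_commutator:
  assumes "is_derivation D" "is_derivation E"
  shows "is_derivation (\<lambda>f. D (E f) - E (D f))"
  using assms by (simp add: is_derivation_def sscale_diff algebra_simps)

lemma vf_apply_lie_bracket: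
  "vf_apply (lie_bracket v w) = (\<lambda>f. vf_apply v (vf_apply w f) - vf_apply w (vf_apply v f))"
  unfolding lie_bracket_def
  by (intro vf_apply_vf_of is_derivation_commutator is_derivation_vf_apply)


section \<open>The Poisson bracket\<close>

definition is_poisson :: "(series \<Rightarrow> series \<Rightarrow> series) \<Rightarrow> bool" where
  "is_poisson P \<longleftrightarrow>
    (\<forall>f g h. P (f + g) h = P f h + P g h) \<and>
    (\<forall>f g h. P f (g + h) = P f g + P f h) \<and>
    (\<forall>r f g. P (sscale r f) g = sscale r (P f g)) \<and>
    (\<forall>r f g. P f (sscale r g) = sscale r (P f g)) \<and>
    (\<forall>f g. P f g = - P g f) \<and>
    (\<forall>f g h. P f (g * h) = P f g * h + g * P f h) \<and>
    P varx vary = varx \<and> P varx varz = 2 * vary \<and> P vary varz = varz"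

text \<open>Well defined: see \<open>is_poisson_iff\<close> and \<open>poisson_eq\<close> below.\<close>

definition poisson :: "series \<Rightarrow> series \<Rightarrow> series" where
  "poisson = (THE P. is_poisson P)"

lemma is_poisson_unique:
  assumes P: "is_poisson P" and Q: "is_poisson Q"
  shows "P = Q"
proof -
  have der: "is_derivation (R f)" if "is_poisson R" for R f
    using that unfolding is_poisson_def is_derivation_def by blast
  have self: "R f f = 0" if "is_poisson R" for R f
  proof -
    have "R f f = - R f f" using that unfolding is_poisson_def by blast
    hence "R f f + R f f = 0" by (rule eq_neg_iff_add_eq_0[THEN iffD1])
    hence "2 * R f f = 0" by (simp only: mult_2)
    thus ?thesis by simp
  qed
  have anti: "R f g = - R g f" if "is_poisson R" for R f g
    using that unfolding is_poisson_def by blast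
  have val: "R varx vary = varx" "R varx varz = 2 * vary" "R vary varz = varz"
    if "is_poisson R" for R
    using that unfolding is_poisson_def by blast+
  have val': "R vary varx = - varx" "R varz varx = - (2 * vary)" "R varz vary = - varz"
    if "is_poisson R" for R
    using anti[OF that, of vary varx] anti[OF that, of varz varx] anti[OF that, of varz vary]
    by (simp_all only: val[OF that])
  have x: "P varx = Q varx" and y: "P vary = Q vary" and z: "P varz = Q varz"
    by (rule derivation_eqI; simp only: der self val val' P Q)+
  have "P f = Q f" for f
  proof (rule derivation_eqI)
    have swap: "P f v = Q f v" if "P v = Q v" for v
      using that anti[OF P, of f v] anti[OF Q, of f v] by simp
    show "P f varx = Q f varx" "P f vary = Q f vary" "P f varz = Q f varz"
      by (rule swap, rule x y z)+
  qed (simp_all only: der P Q)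
  thus ?thesis by blast
qed

definition poisson_coords :: "series \<Rightarrow> series \<Rightarrow> series" where
  "poisson_coords f g =
    varx * (dx f * dy g - dy f * dx g) + 2 * vary * (dx f * dz g - dz f * dx g)
      + varz * (dy f * dz g - dz f * dy g)"

lemma is_poisson_coords: "is_poisson poisson_coords"
  unfolding is_poisson_def
proof (intro conjI allI)
  fix f g h r
  show "poisson_coords (f + g) h = poisson_coords f h + poisson_coords g h"
    "poisson_coords f (g + h) = poisson_coords f g + poisson_coords f h"
    unfolding poisson_coords_def d_add by algebra+
  show "poisson_coords (sscale r f) g = sscale r (poisson_coords f g)"
    "poisson_coords f (sscale r g) = sscale r (poisson_coords f g)"
    unfolding poisson_coords_def d_sscale unfolding sscale_def by algebra+
  show "poisson_coords f g = - poisson_coords g f"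
    unfolding poisson_coords_def by algebra
  show "poisson_coords f (g * h) = poisson_coords f g * h + g * poisson_coords f h"
    unfolding poisson_coords_def d_mult by algebra
qed (simp_all add: poisson_coords_def)

lemma poisson_eq: "poisson = poisson_coords"
  unfolding poisson_def
  by (rule the_equality) (auto intro: is_poisson_coords is_poisson_unique)

lemma is_poisson_iff: "is_poisson P \<longleftrightarrow> P = poisson"
  using is_poisson_coords is_poisson_unique poisson_eq by metis


section \<open>The families\<close>

definition N_field :: vfield where "N_field = (0, varx, 2 * vary)"
definition M_field :: vfield where "M_field = (2 * vary, varz, 0)"

definition kappa :: "nat \<Rightarrow> nat \<Rightarrow> real" where
  "kappa l m = fact m / fact (m - l)"

definition B_field :: "int \<Rightarrow> nat \<Rightarrow> nat \<Rightarrow> vfield" where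
  "B_field l i k =
    vscale (1 / kappa (nat (l + 1)) (2 * i + 2))
      ((lie_bracket N_field ^^ nat (l + 1)) (vf_times (varz ^ i * Delta ^ k) M_field))"

definition b_series :: "int \<Rightarrow> nat \<Rightarrow> nat \<Rightarrow> series" where
  "b_series l i k =
    sscale (- 1 / (real (i + 1) * kappa (nat (l + 1)) (2 * i + 2)))
      ((poisson varx ^^ nat (l + 1)) (varz ^ (i + 1) * Delta ^ k))"

definition index_set :: "(int \<times> nat \<times> nat) set" where
  "index_set = {(l, i, k). i + 2 * k \<ge> 1 \<and> - 1 \<le> l \<and> l \<le> 2 * int i + 1}"


section \<open>Formal infinite sums and the two spaces\<close>

text \<open>Formal sums are taken coefficient by coefficient; they are meaningful for families in which
  every monomial occurs only finitely often. This holds for all families used here,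
  see \<open>b_series_locally_finite\<close> and \<open>B_field_locally_finite\<close> below.\<close>

definition formal_sum :: "('j \<Rightarrow> series) \<Rightarrow> 'j set \<Rightarrow> series" where
  "formal_sum F J =
    Abs_fps (\<lambda>c. Abs_fps (\<lambda>b. Abs_fps (\<lambda>a.
      \<Sum>j\<in>{j\<in>J. coeff3 (F j) a b c \<noteq> 0}. coeff3 (F j) a b c)))"

definition formal_vsum :: "('j \<Rightarrow> vfield) \<Rightarrow> 'j set \<Rightarrow> vfield" where
  "formal_vsum F J =
    (formal_sum (\<lambda>j. fst (F j)) J,
     formal_sum (\<lambda>j. fst (snd (F j))) J,
     formal_sum (\<lambda>j. snd (snd (F j))) J)"

definition b_sum :: "real \<Rightarrow> (int \<Rightarrow> nat \<Rightarrow> nat \<Rightarrow> real) \<Rightarrow> series" where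
  "b_sum c \<beta> = sscale c (b_series 1 0 0)
     + formal_sum (\<lambda>(l, i, k). sscale (\<beta> l i k) (b_series l i k)) index_set"

definition B_sum :: "real \<Rightarrow> (int \<Rightarrow> nat \<Rightarrow> nat \<Rightarrow> real) \<Rightarrow> vfield" where
  "B_sum c \<beta> = vscale c (B_field 1 0 0)
     + formal_vsum (\<lambda>(l, i, k). vscale (\<beta> l i k) (B_field l i k)) index_set"

definition b_space :: "series set" where
  "b_space = {b_sum c \<beta> | c \<beta>. True}"

definition B_space :: "vfield set" where
  "B_space = {B_sum c \<beta> | c \<beta>. True}"

lemma lie_bracket_N:
  "lie_bracket N_field (u, v, w) =
    (vf_apply N_field u, vf_apply N_field v - u, vf_apply N_field w - 2 * v)"
  by (simp add: lie_bracket_def vf_of_def N_field_def d_mult)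

lemma poisson_varx: "poisson varx = vf_apply N_field"
  by (rule ext) (simp add: poisson_eq poisson_coords_def N_field_def)

lemma B_field_100: "B_field 1 0 0 = - N_field"
proof -
  have half: "const3 (1 / 2) * 2 = 1"
    by (simp add: const3_def numeral_fps_const)
  have half_mult: "const3 (1 / 2) * (2 * f) = f" for f
    by (simp only: half mult.assoc[symmetric] mult_1)
  have "lie_bracket N_field M_field = (2 * varx, 0, - (2 * varz))"
    by (simp add: M_field_def lie_bracket_N) (simp add: N_field_def d_mult)
  hence "(lie_bracket N_field ^^ nat (1 + 1)) M_field = (0, 2 * (- varx), 2 * (- (2 * vary)))"
    by (simp add: numeral_2_eq_2 lie_bracket_N) (simp add: N_field_def d_mult d_uminus)
  moreover have "kappa (nat (1 + 1)) (2 * 0 + 2) = 2"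
    by (simp add: kappa_def)
  moreover have "vf_times (varz ^ 0 * Delta ^ 0) M_field = M_field"
    by (simp add: M_field_def)
  ultimately show ?thesis
    by (simp only: B_field_def vscale_def vf_times.simps half_mult) (simp add: N_field_def)
qed

definition homog :: "nat \<Rightarrow> series \<Rightarrow> bool" where
  "homog n f \<longleftrightarrow> (\<forall>a b c. coeff3 f a b c \<noteq> 0 \<longrightarrow> a + b + c = n)"

lemma homog_simps [simp]:
  "homog n 0" "homog 1 varx" "homog 1 vary" "homog 1 varz" "homog 0 1" "homog 0 (const3 r)"
  by (auto simp: homog_def coeff3_vars coeff3_1 split: if_splits)

lemma homog_add: "homog n f \<Longrightarrow> homog n g \<Longrightarrow> homog n (f + g)"
  unfolding homog_def coeff3_simps by (metis add_0)

lemma homog_diff: "homog n f \<Longrightarrow> homog n g \<Longrightarrow> homog n (f - g)"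
  unfolding homog_def coeff3_simps by (metis diff_self)

lemma homog_sscale: "homog n f \<Longrightarrow> homog n (sscale r f)"
  unfolding homog_def coeff3_simps by fastforce

lemma homog_mult:
  assumes "homog m f" "homog n g"
  shows "homog (m + n) (f * g)"
  unfolding homog_def
proof (intro allI impI)
  fix a b c assume "coeff3 (f * g) a b c \<noteq> 0"
  then obtain i j k where ijk: "i \<le> a" "j \<le> b" "k \<le> c"
    and "coeff3 f i j k * coeff3 g (a - i) (b - j) (c - k) \<noteq> 0"
    unfolding coeff3_mult by (metis (no_types, lifting) atLeastAtMost_iff sum.neutral)
  hence "coeff3 f i j k \<noteq> 0" "coeff3 g (a - i) (b - j) (c - k) \<noteq> 0" by auto
  hence "i + j + k = m" "(a - i) + (b - j) + (c - k) = n"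
    using assms unfolding homog_def by blast+
  thus "a + b + c = m + n" using ijk by linarith
qed

lemma homog_power: "homog m f \<Longrightarrow> homog (m * n) (f ^ n)"
  by (induction n) (auto dest: homog_mult)

lemma homog_Delta: "homog 2 Delta"
proof -
  have "homog (1 + 1) (varx * varz)" "homog (1 * 2) (vary ^ 2)"
    by (intro homog_mult homog_power homog_simps)+
  thus ?thesis unfolding Delta_def by (intro homog_diff) (simp_all add: numeral_2_eq_2)
qed

lemma homog_var_d:
  assumes f: "homog n f" and v: "homog 1 v"
  shows "homog n (v * dx f)" "homog n (v * dy f)" "homog n (v * dz f)"
proof -
  have *: "homog n (v * g)"
    if g: "\<And>a b c. coeff3 g a b c \<noteq> 0 \<Longrightarrow> Suc (a + b + c) = n" for g
  proof (cases n)
    case 0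
    have "coeff3 g a b c = 0" for a b c
      using g[of a b c] 0 by (cases "coeff3 g a b c = 0") simp_all
    hence "g = 0" by (intro series_eqI) (simp only: coeff3_simps)
    thus ?thesis by simp
  next
    case (Suc m)
    hence "homog m g" using g unfolding homog_def by (metis Suc_inject)
    from homog_mult[OF v this] show ?thesis by (simp add: Suc)
  qed
  have f': "a + b + c = n" if "coeff3 f a b c \<noteq> 0" for a b c
    using f that unfolding homog_def by blast
  show "homog n (v * dx f)"
  proof (rule *)
    fix a b c assume "coeff3 (dx f) a b c \<noteq> 0"
    hence "coeff3 f (Suc a) b c \<noteq> 0" by (simp add: coeff3_d)
    from f'[OF this] show "Suc (a + b + c) = n" by simp
  qed
  show "homog n (v * dy f)"
  proof (rule *)
    fix a b c assume "coeff3 (dy f) a b c \<noteq> 0"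
    hence "coeff3 f a (Suc b) c \<noteq> 0" by (simp add: coeff3_d)
    from f'[OF this] show "Suc (a + b + c) = n" by simp
  qed
  show "homog n (v * dz f)"
  proof (rule *)
    fix a b c assume "coeff3 (dz f) a b c \<noteq> 0"
    hence "coeff3 f a b (Suc c) \<noteq> 0" by (simp add: coeff3_d)
    from f'[OF this] show "Suc (a + b + c) = n" by simp
  qed
qed

lemma homog_N: "homog n f \<Longrightarrow> homog n (vf_apply N_field f)"
  unfolding N_field_def vf_apply.simps mult_2 distrib_right
  by (intro homog_add homog_var_d homog_simps)

definition vhomog :: "nat \<Rightarrow> vfield \<Rightarrow> bool" where
  "vhomog n v \<longleftrightarrow> homog n (fst v) \<and> homog n (fst (snd v)) \<and> homog n (snd (snd v))"

lemma vhomog_ad_N: "vhomog n v \<Longrightarrow> vhomog n (lie_bracket N_field v)"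
  by (cases v) (simp only: vhomog_def lie_bracket_N mult_2 fst_conv snd_conv homog_N homog_diff homog_add)

lemma homog_b_series: "homog (i + 2 * k + 1) (b_series l i k)"
proof -
  have "homog (1 * (i + 1) + 2 * k) (varz ^ (i + 1) * Delta ^ k)"
    by (intro homog_mult homog_power homog_simps homog_Delta)
  hence "homog (i + 2 * k + 1) ((poisson varx ^^ n) (varz ^ (i + 1) * Delta ^ k))" for n
    by (induction n) (simp_all add: poisson_varx homog_N del: power_Suc)
  thus ?thesis unfolding b_series_def by (rule homog_sscale)
qed

lemma vhomog_B_field: "vhomog (i + 2 * k + 1) (B_field l i k)"
proof -
  have h: "homog (1 * i + 2 * k) (varz ^ i * Delta ^ k)"
    by (intro homog_mult homog_power homog_simps homog_Delta)
  have "vhomog (i + 2 * k + 1) (vf_times (varz ^ i * Delta ^ k) M_field)"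
    using homog_mult[OF h homog_simps(3)] homog_mult[OF h homog_simps(4)]
    by (simp only: vhomog_def M_field_def vf_times.simps fst_conv snd_conv mult_2 distrib_left
        homog_add mult_1 mult_zero_right homog_simps)
  hence "vhomog (i + 2 * k + 1)
      ((lie_bracket N_field ^^ n) (vf_times (varz ^ i * Delta ^ k) M_field))" for n
    by (induction n) (simp_all only: funpow.simps comp_apply id_apply vhomog_ad_N)
  moreover have "vhomog m (vscale r v)" if "vhomog m v" for m r v
    using that by (cases v)
      (simp only: vhomog_def vscale_def vf_times.simps fst_conv snd_conv sscale_def[symmetric]
        homog_sscale)
  ultimately show ?thesis unfolding B_field_def by simp
qed

lemma finite_index_degree: "finite {(l, i, k). (l, i, k) \<in> index_set \<and> i + 2 * k + 1 = n}"
proof (rule finite_subset)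
  show "{(l, i, k). (l, i, k) \<in> index_set \<and> i + 2 * k + 1 = n}
      \<subseteq> {- 1..2 * int n + 1} \<times> {..n} \<times> {..n}"
    by (auto simp: index_set_def)
qed simp

lemma b_series_locally_finite:
  "finite {(l, i, k). (l, i, k) \<in> index_set \<and> coeff3 (b_series l i k) a b c \<noteq> 0}"
proof (rule finite_subset[OF _ finite_index_degree[of "a + b + c"]])
  have "i + 2 * k + 1 = a + b + c" if "coeff3 (b_series l i k) a b c \<noteq> 0" for l i k
    using homog_b_series[of i k l] that unfolding homog_def by metis
  thus "{(l, i, k). (l, i, k) \<in> index_set \<and> coeff3 (b_series l i k) a b c \<noteq> 0}
      \<subseteq> {(l, i, k). (l, i, k) \<in> index_set \<and> i + 2 * k + 1 = a + b + c}"
    by blast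
qed

lemma B_field_locally_finite:
  "finite {(l, i, k). (l, i, k) \<in> index_set \<and>
     (coeff3 (fst (B_field l i k)) a b c \<noteq> 0 \<or>
      coeff3 (fst (snd (B_field l i k))) a b c \<noteq> 0 \<or>
      coeff3 (snd (snd (B_field l i k))) a b c \<noteq> 0)}" (is "finite ?S")
proof (rule finite_subset[OF _ finite_index_degree[of "a + b + c"]])
  have "i + 2 * k + 1 = a + b + c"
    if "coeff3 (fst (B_field l i k)) a b c \<noteq> 0 \<or>
      coeff3 (fst (snd (B_field l i k))) a b c \<noteq> 0 \<or>
      coeff3 (snd (snd (B_field l i k))) a b c \<noteq> 0" for l i k
    using vhomog_B_field[of i k l] that unfolding homog_def vhomog_def by metis
  thus "?S \<subseteq> {(l, i, k). (l, i, k) \<in> index_set \<and> i + 2 * k + 1 = a + b + c}"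
    by blast
qed


section \<open>Lie algebras and Lie isomorphisms\<close>

definition lie_algebra_on ::
    "(real \<Rightarrow> 'a::ab_group_add \<Rightarrow> 'a) \<Rightarrow> 'a set \<Rightarrow> ('a \<Rightarrow> 'a \<Rightarrow> 'a) \<Rightarrow> bool" where
  "lie_algebra_on scale V br \<longleftrightarrow>
    vector_space scale \<and> module.subspace scale V \<and>
    (\<forall>u\<in>V. \<forall>v\<in>V. br u v \<in> V) \<and>
    (\<forall>u\<in>V. \<forall>v\<in>V. \<forall>w\<in>V. br (u + v) w = br u w + br v w \<and> br u (v + w) = br u v + br u w) \<and>
    (\<forall>r. \<forall>u\<in>V. \<forall>v\<in>V. br (scale r u) v = scale r (br u v) \<and> br u (scale r v) = scale r (br u v)) \<and>
    (\<forall>u\<in>V. br u u = 0) \<and>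
    (\<forall>u\<in>V. \<forall>v\<in>V. \<forall>w\<in>V. br u (br v w) + br v (br w u) + br w (br u v) = 0)"

definition lie_isomorphism ::
    "(real \<Rightarrow> 'a::ab_group_add \<Rightarrow> 'a) \<Rightarrow> 'a set \<Rightarrow> ('a \<Rightarrow> 'a \<Rightarrow> 'a) \<Rightarrow>
     (real \<Rightarrow> 'b::ab_group_add \<Rightarrow> 'b) \<Rightarrow> 'b set \<Rightarrow> ('b \<Rightarrow> 'b \<Rightarrow> 'b) \<Rightarrow> ('a \<Rightarrow> 'b) \<Rightarrow> bool" where
  "lie_isomorphism scale V br scale' V' br' \<phi> \<longleftrightarrow>
    lie_algebra_on scale V br \<and> lie_algebra_on scale' V' br' \<and>
    bij_betw \<phi> V V' \<and>
    (\<forall>u\<in>V. \<forall>v\<in>V. \<phi> (u + v) = \<phi> u + \<phi> v) \<and>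
    (\<forall>r. \<forall>u\<in>V. \<phi> (scale r u) = scale' r (\<phi> u)) \<and>
    (\<forall>u\<in>V. \<forall>v\<in>V. \<phi> (br u v) = br' (\<phi> u) (\<phi> v))"


section \<open>The map Psi\<close>

text \<open>The linear, term-by-term extension of \<open>b_series l i k \<mapsto> B_field l i k\<close>. The description is
  unique for \<open>f \<in> b_space\<close> because the coefficients of \<open>f\<close> over \<open>index_set\<close> are uniquely determined; only the
  values on \<open>b_space\<close> matter.\<close>

definition Psi :: "series \<Rightarrow> vfield" where
  "Psi f = (THE v. \<exists>c \<beta>. f = b_sum c \<beta> \<and> v = B_sum c \<beta>)"

end

theory Submission
  imports Defs
begin

text \<open>
  On the space spanned by the \<open>b_series\<close>, the map \<open>Psi\<close> sends \<open>f\<close> to its Hamiltonian vector field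
  \<open>{f, -}\<close>, so it respects brackets by the Jacobi identity; its kernel consists of invariants.
  Every bracket \<open>{f, g}\<close> is a sum of brackets \<open>{v, h}\<close> with \<open>v\<close> a coordinate, because the linear Poisson
  structure is unimodular. In degree \<open>n \<ge> 2\<close> the homogeneous polynomials are spanned by the \<open>b_series\<close> and,
  for even \<open>n\<close>, a power of \<open>Delta\<close>. The Casimir operator of the coordinates (a copy of sl(2))
  commutes with all \<open>{v, -}\<close>, has eigenvalues \<open>- 2 m (m + 1)\<close> with \<open>1 \<le> m \<le> n\<close> on the \<open>b_series\<close>, and vanishes
  on invariants. Hence a suitable polynomial in it annihilates the \<open>b_series\<close> but acts on invariants as a
  nonzero scalar: this excludes powers of \<open>Delta\<close> from brackets and invariants from the span of
  the \<open>b_series\<close>.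
\<close>

section \<open>Scalars and the two vector spaces\<close>

lemma const3_mult: "const3 (r * s) = const3 r * const3 s"
  and const3_add: "const3 (r + s) = const3 r + const3 s"
  and const3_minus: "const3 (- r) = - const3 r"
  by (simp_all add: const3_def)

lemma const3_of_nat: "const3 (real n) = of_nat n"
  by (simp add: const3_def fps_of_nat)

lemma vector_space_sscale: "vector_space sscale"
  by unfold_locales (simp_all add: sscale_def const3_mult const3_add algebra_simps)

lemma vector_space_vscale: "vector_space vscale"
  by unfold_locales
    (auto simp: vscale_def const3_mult const3_add algebra_simps)

interpretation S: vector_space sscale by (rule vector_space_sscale)

section \<open>Calculus of the Poisson bracket\<close>

lemma
  shows poisson_add_left: "poisson (f + g) h = poisson f h + poisson g h"
    and poisson_add_right: "poisson f (g + h) = poisson f g + poisson f h"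
    and poisson_sscale_left: "poisson (sscale r f) g = sscale r (poisson f g)"
    and poisson_sscale_right: "poisson f (sscale r g) = sscale r (poisson f g)"
    and poisson_antisym: "poisson f g = - poisson g f"
    and poisson_mult_right: "poisson f (g * h) = poisson f g * h + g * poisson f h"
  using is_poisson_iff[of poisson] unfolding is_poisson_def by blast+

lemma is_derivation_poisson: "is_derivation (poisson f)"
  unfolding is_derivation_def
  by (simp add: poisson_add_right poisson_sscale_right poisson_mult_right)

lemma poisson_vars [simp]:
  "poisson varx varx = 0" "poisson varx vary = varx" "poisson varx varz = 2 * vary"
  "poisson vary varx = - varx" "poisson vary vary = 0" "poisson vary varz = varz"
  "poisson varz varx = - 2 * vary" "poisson varz vary = - varz" "poisson varz varz = 0"
  by (simp_all add: poisson_eq poisson_coords_def)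

lemma poisson_self [simp]: "poisson f f = 0"
  by (simp add: poisson_eq poisson_coords_def mult.commute)

lemma poisson_diff_right: "poisson f (g - h) = poisson f g - poisson f h"
  by (simp add: poisson_eq poisson_coords_def algebra_simps)

lemma poisson_uminus_right: "poisson f (- g) = - poisson f g"
  by (simp add: poisson_eq poisson_coords_def algebra_simps)

lemma poisson_const [simp]:
  "poisson f 0 = 0" "poisson f 1 = 0" "poisson f (numeral k) = 0" "poisson f (const3 r) = 0"
  "poisson f (of_nat n) = 0"
  using d_const[of "real n"]
  by (simp_all add: poisson_eq poisson_coords_def const3_of_nat)

lemma poisson_0_left [simp]: "poisson 0 g = 0"
  using poisson_antisym[of 0 g] by simp

lemma poisson_power: "poisson f (g ^ Suc n) = of_nat (Suc n) * g ^ n * poisson f g"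
  by (induction n) (simp_all add: poisson_mult_right algebra_simps)

lemma poisson_power': "poisson f (g ^ n) = of_nat n * g ^ (n - 1) * poisson f g"
  by (cases n) (simp_all add: poisson_power del: power_Suc of_nat_Suc)

lemma poisson_vars_Delta [simp]:
  "poisson varx Delta = 0" "poisson vary Delta = 0" "poisson varz Delta = 0"
  by (simp_all add: Delta_def poisson_diff_right poisson_mult_right poisson_power'
      algebra_simps power2_eq_square)

text \<open>\<open>poisson Delta\<close> is a derivation that vanishes on the coordinates, hence
  everywhere.\<close>

lemma poisson_Delta [simp]: "poisson f Delta = 0"
proof -
  have "poisson Delta = (\<lambda>_. 0)"
  proof (rule derivation_eqI)
    show "is_derivation (\<lambda>_. 0)" by (simp add: is_derivation_def sscale_def)
  qed (simp_all add: is_derivation_poisson poisson_antisym[of Delta])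
  thus ?thesis using poisson_antisym[of f Delta] by simp
qed

lemma poisson_Delta_power [simp]: "poisson f (Delta ^ k) = 0"
  by (simp add: poisson_power')

section \<open>Jacobi identity and divergence form\<close>

lemma d_commute: "dx (dy f) = dy (dx f)" "dx (dz f) = dz (dx f)" "dy (dz f) = dz (dy f)"
  by (auto intro!: series_eqI simp: coeff3_d)

text \<open>Both sides are derivations in \<open>h\<close>, and by antisymmetry the identity is invariant under cyclic
  rotation of \<open>f, g, h\<close>; hence it only has to be checked for coordinates.\<close>

lemma poisson_jacobi:
  "poisson (poisson f g) h = poisson f (poisson g h) - poisson g (poisson f h)"
proof -
  note der = is_derivation_poisson is_derivation_commutator
  define J where "J f g h \<longleftrightarrow>
    poisson (poisson f g) h = poisson f (poisson g h) - poisson g (poisson f h)" for f g h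
  have ext: "J f g h" if "J f g varx" "J f g vary" "J f g varz" for f g h
  proof -
    have "poisson (poisson f g) = (\<lambda>h. poisson f (poisson g h) - poisson g (poisson f h))"
      using that by (intro derivation_eqI der) (simp_all add: J_def)
    thus ?thesis by (simp add: J_def fun_eq_iff)
  qed
  have rot: "J g h f" if "J f g h" for f g h
    using that poisson_antisym[of "poisson g h" f] poisson_antisym[of h f]
      poisson_antisym[of "poisson f g" h] poisson_antisym[of g f]
    by (simp add: J_def poisson_uminus_right)
  define vars where "vars = {varx, vary, varz}"
  have 1: "J u v w" if "u \<in> vars" "v \<in> vars" "w \<in> vars" for u v w
    using that unfolding vars_def J_def
    by (elim insertE emptyE; hypsubst)
      (simp_all add: poisson_uminus_right poisson_mult_right poisson_antisym[of "2 * _"]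
        poisson_antisym[of "- _"])
  have 2: "J u v h" if "u \<in> vars" "v \<in> vars" for u v h
    by (rule ext) (use that 1 in \<open>auto simp: vars_def\<close>)
  have 3: "J h u g" if "u \<in> vars" for u g h
    by (rule ext) (use that 2 rot in \<open>auto simp: vars_def\<close>)
  have "J f g h"
    by (rule ext) (use 3 rot in \<open>auto simp: vars_def\<close>)
  thus ?thesis by (simp add: J_def)
qed

text \<open>By the Leibniz rule the right side is \<open>poisson f g\<close> plus \<open>g\<close>
  times the sum of the brackets of each coordinate with the matching partial derivative of
  \<open>f\<close>. That sum pairs the antisymmetric brackets of coordinates with the symmetric
  second derivatives, so it vanishes.\<close>

lemma poisson_divergence_form:
  "poisson f g = poisson varx (dx f * g) + poisson vary (dy f * g) + poisson varz (dz f * g)"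
  by (simp add: poisson_eq poisson_coords_def d_mult d_commute algebra_simps)

section \<open>Hamiltonian vector fields\<close>

definition ham :: "series \<Rightarrow> vfield" where
  "ham f = vf_of (poisson f)"

lemma vf_apply_ham: "vf_apply (ham f) = poisson f"
  by (simp add: ham_def vf_apply_vf_of is_derivation_poisson)

lemma lie_bracket_ham: "lie_bracket (ham f) (ham g) = ham (poisson f g)"
  unfolding lie_bracket_def vf_apply_ham ham_def[of "poisson f g"]
  by (simp add: vf_of_def poisson_jacobi)

lemma ham_add: "ham (f + g) = ham f + ham g"
  by (simp add: ham_def vf_of_def poisson_add_left)

lemma ham_sscale: "ham (sscale r f) = vscale r (ham f)"
  by (simp add: ham_def vf_of_def poisson_sscale_left vscale_def flip: sscale_def)

lemma ham_varx: "ham varx = N_field"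
  by (simp add: ham_def vf_of_def N_field_def)

text \<open>Since \<open>ham varx = N_field\<close>, iterated brackets with \<open>varx\<close>
  become iterated brackets with \<open>N_field\<close>. Moreover {z, -} = -M and
  \<open>Delta\<close> is central, so z^(i+1) Delta^k goes to -(i+1) z^i Delta^k M; the
  normalisation of \<open>b_series\<close> cancels this factor.\<close>

lemma ham_b_series: "ham (b_series l i k) = B_field l i k"
proof -
  have "ham ((poisson varx ^^ n) f) = (lie_bracket N_field ^^ n) (ham f)" for n f
    by (induction n) (simp_all flip: lie_bracket_ham add: ham_varx)
  moreover have "poisson (varz ^ Suc i * Delta ^ k) v
      = of_nat (Suc i) * (varz ^ i * Delta ^ k * poisson varz v)" for v
    by (subst poisson_antisym, simp only: poisson_mult_right poisson_power poisson_antisym[of v varz]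
        poisson_Delta_power) (simp add: algebra_simps)
  hence "ham (varz ^ (i + 1) * Delta ^ k)
    = vscale (- real (i + 1)) (vf_times (varz ^ i * Delta ^ k) M_field)"
    by (simp only: ham_def vf_of_def M_field_def vscale_def vf_times.simps Suc_eq_plus1 poisson_vars)
      (simp add: const3_minus const3_of_nat algebra_simps del: of_nat_Suc)
  moreover have "(lie_bracket N_field ^^ n) (vscale r v) = vscale r ((lie_bracket N_field ^^ n) v)"
    for n r v
  proof (induction n)
    case (Suc n)
    have "lie_bracket N_field (vscale r w) = vscale r (lie_bracket N_field w)" for w
      by (cases w) (simp add: vscale_def lie_bracket_N right_diff_distrib
          is_derivation_vf_apply[unfolded is_derivation_def sscale_def, THEN conjunct2,
            THEN conjunct1, rule_format]
          del: vf_apply.simps)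
    thus ?case using Suc by simp
  qed simp
  ultimately have "ham (b_series l i k) =
      vscale (- 1 / (real (i + 1) * kappa (nat (l + 1)) (2 * i + 2)))
        (vscale (- real (i + 1)) ((lie_bracket N_field ^^ nat (l + 1))
          (vf_times (varz ^ i * Delta ^ k) M_field)))"
    by (simp only: b_series_def ham_sscale)
  thus ?thesis
    by (simp add: B_field_def vector_space.vector_space_assms(3)[OF vector_space_vscale]
        del: of_nat_Suc)
qed

section \<open>The Casimir operator\<close>

text \<open>This is 2 (x z - y^2) with each coordinate replaced by its bracket operator and the
  product of x and z symmetrised.\<close>

definition casimir :: "series \<Rightarrow> series" where
  "casimir f = poisson varx (poisson varz f) + poisson varz (poisson varx f)
     - 2 * poisson vary (poisson vary f)"

lemma casimir_add: "casimir (f + g) = casimir f + casimir g"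
  by (simp add: casimir_def poisson_add_right algebra_simps)

lemma casimir_sscale: "casimir (sscale r f) = sscale r (casimir f)"
  by (simp add: casimir_def poisson_sscale_right) (simp add: sscale_def algebra_simps)

lemma casimir_poisson:
  assumes "v \<in> {varx, vary, varz}"
  shows "casimir (poisson v f) = poisson v (casimir f)"
proof -
  \<comment> \<open>The Jacobi identity for pairs of coordinates, oriented to move
    \<open>varz\<close> outermost and \<open>varx\<close> innermost; both sides of the claim then
    reach the same normal form.\<close>
  have 1: "poisson varx (poisson vary g) = poisson vary (poisson varx g) + poisson varx g" for g
    using poisson_jacobi[of varx vary g] by (simp add: eq_diff_eq add.commute)
  have 2: "poisson vary (poisson varz g) = poisson varz (poisson vary g) + poisson varz g" for g
    using poisson_jacobi[of vary varz g] by (simp add: eq_diff_eq add.commute)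
  have 3: "poisson varx (poisson varz g) = poisson varz (poisson varx g) + 2 * poisson vary g" for g
  proof -
    have "poisson (2 * vary) g = 2 * poisson vary g"
      by (subst (1 2) poisson_antisym) (simp add: poisson_mult_right)
    thus ?thesis using poisson_jacobi[of varx varz g] by (simp add: algebra_simps)
  qed
  show ?thesis using assms
    by (elim insertE emptyE; hypsubst)
      (simp_all add: casimir_def 1 2 3 poisson_add_right poisson_diff_right poisson_mult_right algebra_simps)
qed

text \<open>The product of \<open>casimir - c\<close> over the eigenvalues \<open>c = - 2 m (m + 1)\<close>, \<open>1 \<le> m \<le> n\<close>.\<close>

fun casimir_prod :: "nat \<Rightarrow> series \<Rightarrow> series" where
  "casimir_prod 0 f = f"
| "casimir_prod (Suc n) f =
    casimir (casimir_prod n f) + sscale (2 * (real n + 1) * (real n + 2)) (casimir_prod n f)"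

lemma casimir_prod_add: "casimir_prod n (f + g) = casimir_prod n f + casimir_prod n g"
  by (induction n) (simp_all add: casimir_add S.scale_right_distrib)

lemma casimir_prod_sscale: "casimir_prod n (sscale r f) = sscale r (casimir_prod n f)"
  by (induction n) (simp_all add: casimir_sscale S.scale_right_distrib mult.commute)

lemma casimir_prod_0: "casimir_prod n 0 = 0"
  using casimir_prod_sscale[of n 0 0] by simp

lemma casimir_prod_poisson:
  "v \<in> {varx, vary, varz} \<Longrightarrow>
    casimir_prod n (poisson v f) = poisson v (casimir_prod n f)"
  by (induction n) (simp_all add: casimir_poisson poisson_add_right poisson_sscale_right)

lemma casimir_prod_eigenvector:
  assumes "casimir f = sscale r f"
  shows "casimir_prod n f = sscale (\<Prod>j<n. r + 2 * (real j + 1) * (real j + 2)) f"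
  using assms
  by (induction n) (simp_all add: casimir_sscale algebra_simps flip: S.scale_left_distrib)

text \<open>Invariants have Casimir eigenvalue 0, so the scalar is a product of positive
  numbers.\<close>

lemma casimir_prod_invariant:
  assumes "poisson varx f = 0" "poisson vary f = 0" "poisson varz f = 0"
  shows "\<exists>r. r \<noteq> 0 \<and> casimir_prod n f = sscale r f"
proof (intro exI conjI)
  have "casimir f = sscale 0 f" using assms by (simp add: casimir_def)
  thus "casimir_prod n f = sscale (\<Prod>j<n. 0 + 2 * (real j + 1) * (real j + 2)) f"
    by (rule casimir_prod_eigenvector)
  have "real j + 1 \<noteq> 0" "real j + 2 \<noteq> 0" for j by linarith+
  thus "(\<Prod>j<n. 0 + 2 * (real j + 1) * (real j + 2)) \<noteq> 0" by simp
qed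

section \<open>Weight strings\<close>

text \<open>The start z^m Delta^k is an extremal weight vector: {z, -} kills it and {y, -}
  multiplies it by m. Each bracket with \<open>varx\<close> lowers the weight by one.\<close>

definition wvec :: "nat \<Rightarrow> nat \<Rightarrow> nat \<Rightarrow> series" where
  "wvec j m k = (poisson varx ^^ j) (varz ^ m * Delta ^ k)"

text \<open>Only j = 0 needs computing, as the Casimir operator commutes with {x, -}. There {x, {z,
  f}} = 0, {z, {x, f}} = -2 m f and {y, {y, f}} = m^2 f.\<close>

lemma casimir_wvec: "casimir (wvec j m k) = sscale (- 2 * real m * (real m + 1)) (wvec j m k)"
proof (induction j)
  case 0
  show ?case
  proof (cases m)
    case (Suc i)
    define s :: series where "s = of_nat m"
    define f where "f = varz ^ m * Delta ^ k"
    have z: "poisson varz f = 0"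
      by (simp add: f_def poisson_mult_right poisson_power')
    have y: "poisson vary f = s * f"
      by (simp add: f_def s_def Suc poisson_mult_right poisson_power del: power_Suc of_nat_Suc)
        (simp add: mult_ac)
    have x: "poisson varx f = s * (2 * (vary * (varz ^ i * Delta ^ k)))"
      by (simp add: f_def s_def Suc poisson_mult_right poisson_power mult_ac del: power_Suc of_nat_Suc)
    have zx: "poisson varz (poisson varx f) = - (2 * (s * f))"
      unfolding x by (simp add: s_def poisson_mult_right poisson_power') (simp add: f_def Suc mult_ac)
    have yy: "poisson vary (poisson vary f) = s * (s * f)"
      by (simp add: y s_def poisson_mult_right)
    have "sscale (- 2 * real m * (real m + 1)) f = - (2 * (s * f)) - 2 * (s * (s * f))"
      unfolding sscale_def const3_mult const3_add const3_minus const3_of_nat const3_eq s_def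
      by (simp add: algebra_simps)
    thus ?thesis using zx yy z by (simp add: casimir_def wvec_def flip: f_def)
  qed (simp add: wvec_def casimir_def)
next
  case (Suc j)
  thus ?case by (simp add: wvec_def casimir_poisson poisson_sscale_right poisson_uminus_right)
qed

lemma casimir_prod_wvec:
  assumes "1 \<le> m" "m \<le> n"
  shows "casimir_prod n (wvec j m k) = 0"
proof -
  \<comment> \<open>The factor at j = m - 1 is zero.\<close>
  have "(\<Prod>j<n. - 2 * real m * (real m + 1) + 2 * (real j + 1) * (real j + 2)) = 0"
    using assms by (intro prod_zero bexI[of _ "m - 1"]) (auto simp: of_nat_diff algebra_simps)
  thus ?thesis using casimir_prod_eigenvector[OF casimir_wvec] by simp
qed

lemma wvec_Delta: "wvec j m k = Delta ^ k * wvec j m 0"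
  by (induction j) (simp_all add: wvec_def poisson_mult_right)

text \<open>The Leibniz formula for iterated derivations stops after three terms, because {x, z} = 2
  y, {x, 2 y} = 2 x and {x, x} = 0.\<close>

lemma adx_power_mult_varz:
  "(poisson varx ^^ Suc (Suc j)) (varz * f) =
     varz * (poisson varx ^^ Suc (Suc j)) f
     + 2 * of_nat (j + 2) * vary * (poisson varx ^^ Suc j) f
     + of_nat (j + 2) * of_nat (j + 1) * varx * (poisson varx ^^ j) f"
  by (induction j) (simp_all add: poisson_mult_right poisson_add_right algebra_simps)

text \<open>Once \<open>Delta ^ k\<close> is split off, induct on \<open>m\<close>: the three-term
  formula expresses the vector at j and m + 1 by those at j, j - 1, j - 2 and m, so each factor
  \<open>varz\<close> raises the bound by two.\<close>

lemma wvec_eq_0: "2 * m < j \<Longrightarrow> wvec j m k = 0"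
proof -
  assume "2 * m < j"
  hence "wvec j m 0 = 0"
  proof (induction m arbitrary: j)
    case 0
    then obtain i where "j = Suc i" by (auto simp: gr0_conv_Suc)
    moreover have "(poisson varx ^^ i) 0 = 0" for i by (induction i) simp_all
    ultimately show ?case by (simp add: wvec_def funpow_swap1)
  next
    case (Suc m)
    then obtain i where "j = Suc (Suc i)" "2 * m < i" by (metis Suc_less_eq2 add_2_eq_Suc mult_Suc_right)
    thus ?case using Suc.IH[of i] Suc.IH[of "Suc i"] Suc.IH[of "Suc (Suc i)"]
      adx_power_mult_varz[of i "varz ^ m"] by (simp add: wvec_def del: funpow.simps)
  qed
  thus ?thesis by (simp add: wvec_Delta[of j m k])
qed

section \<open>Spanning the homogeneous polynomials\<close>

text \<open>Here m = 0 is allowed, so for even \<open>n\<close> the span contains a power of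
  \<open>Delta\<close>, in contrast to \<open>bspan\<close> below.\<close>

definition wspan :: "nat \<Rightarrow> series set" where
  "wspan n = S.span {wvec j m k | j m k. m + 2 * k = n}"

lemma wvec_in_wspan: "m + 2 * k = n \<Longrightarrow> wvec j m k \<in> wspan n"
  unfolding wspan_def by (intro S.span_base) blast

lemma wspan_adx: "f \<in> wspan n \<Longrightarrow> poisson varx f \<in> wspan n"
  unfolding wspan_def
proof (induction rule: S.span_induct_alt)
  case (step c x y)
  then obtain j m k where "x = wvec j m k" "m + 2 * k = n" by blast
  hence "poisson varx x \<in> S.span {wvec j m k | j m k. m + 2 * k = n}"
    using wvec_in_wspan[of m k n "Suc j"] by (simp add: wspan_def wvec_def)
  thus ?case using step by (simp add: poisson_add_right poisson_sscale_right S.span_add S.span_scale)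
qed (simp add: S.span_zero)

lemma wspan_Delta: "f \<in> wspan n \<Longrightarrow> Delta * f \<in> wspan (n + 2)"
  unfolding wspan_def
proof (induction rule: S.span_induct_alt)
  case (step c x y)
  then obtain j m k where x: "x = wvec j m k" "m + 2 * k = n" by blast
  hence "Delta * x = wvec j m (Suc k)" using wvec_Delta[of j m k] wvec_Delta[of j m "Suc k"]
    by (simp add: mult.assoc)
  hence "Delta * x \<in> S.span {wvec j m k | j m k. m + 2 * k = n + 2}"
    using wvec_in_wspan[of m "Suc k" "n + 2" j] x by (simp add: wspan_def)
  moreover have "Delta * (sscale c x + y) = sscale c (Delta * x) + Delta * y"
    by (simp add: sscale_def algebra_simps)
  ultimately show ?case using step by (simp add: S.span_add S.span_scale)
qed (simp add: S.span_zero)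

lemma wspan_subspace: "S.subspace (wspan n)"
  unfolding wspan_def by (rule S.subspace_span)

lemma wspan_cancel: "r \<noteq> 0 \<Longrightarrow> sscale r f \<in> wspan n \<Longrightarrow> f \<in> wspan n"
  using S.subspace_scale[OF wspan_subspace, of "sscale r f" n "1 / r"] by simp

lemma adx_varx_power: "poisson varx (varx ^ d * f) = varx ^ d * poisson varx f"
  by (simp add: poisson_mult_right poisson_power')

lemma adx_varz_power:
  "poisson varx (varz ^ Suc e) = sscale (2 * (real e + 1)) (vary * varz ^ e)"
proof -
  have "const3 (2 * (real e + 1)) = 2 * of_nat (Suc e)"
    by (simp add: const3_mult const3_add const3_of_nat)
  thus ?thesis by (simp add: poisson_power sscale_def mult_ac del: power_Suc of_nat_Suc)
qed

text \<open>The Leibniz rule gives x z^(g+1) + 2 (g+1) y^2 z^g; then y^2 is replaced by x z -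
  Delta.\<close>

lemma adx_vary_varz_power:
  "poisson varx (vary * varz ^ Suc g) =
     sscale (2 * (real g + 1) + 1) (varx * varz ^ Suc g) - sscale (2 * (real g + 1)) (Delta * varz ^ g)"
proof -
  define s where "s = const3 (2 * (real g + 1))"
  have "varx * (varz * p) + vary * (s * (vary * p)) =
      (s + 1) * (varx * (varz * p)) - s * ((varx * varz - vary ^ 2) * p)" for p
    by algebra
  thus ?thesis
    unfolding poisson_mult_right adx_varz_power sscale_def const3_add const3_eq s_def[symmetric] Delta_def
    by simp
qed

lemma adx_wspan_cancel:
  assumes "poisson varx (varx ^ d * varz ^ Suc e) \<in> wspan n"
  shows "varx ^ d * vary * varz ^ e \<in> wspan n"
proof -
  have "poisson varx (varx ^ d * varz ^ Suc e) = sscale (2 * (real e + 1)) (varx ^ d * vary * varz ^ e)"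
    unfolding adx_varx_power adx_varz_power by (simp add: sscale_def mult_ac)
  hence "sscale (2 * (real e + 1)) (varx ^ d * vary * varz ^ e) \<in> wspan n"
    using assms by (simp only:)
  moreover have "2 * (real e + 1) > 0" by (simp add: add_nonneg_pos)
  ultimately show ?thesis by (rule wspan_cancel[OF less_imp_neq[THEN not_sym], rotated])
qed

text \<open>Modulo \<open>Delta\<close> one has \<open>y\<^sup>2 = x z\<close>, so iterating the bracket with \<open>x\<close> carries \<open>z\<^sup>n\<close> through nonzero
  multiples of all degree \<open>n\<close> monomials without factor \<open>y\<^sup>2\<close>, in the order \<open>y z\<^sup>n\<^sup>-\<^sup>1\<close>, \<open>x z\<^sup>n\<^sup>-\<^sup>1\<close>, \<open>x y z\<^sup>n\<^sup>-\<^sup>2\<close>, ...\<close>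

lemma monomial_in_wspan: "varx ^ a * vary ^ b * varz ^ c \<in> wspan (a + b + c)"
proof (induction "a + b + c" arbitrary: a b c rule: less_induct)
  case less
  let ?n = "a + b + c"
  \<comment> \<open>Multiples of \<open>Delta\<close> come from the outer induction, two degrees
    lower.\<close>
  have IH: "Delta * (varx ^ d * vary ^ e * varz ^ g) \<in> wspan ?n" if "d + e + g + 2 = ?n" for d e g
    using wspan_Delta[OF less[of d e g]] that by simp
  \<comment> \<open>Monomials without y, by induction on the exponent of x: two brackets with
    \<open>varx\<close> lead from x^d z^(e+1) through x^d y z^e to x^(d+1) z^e, up to nonzero
    factors and a multiple of \<open>Delta\<close>.\<close>
  have b0: "varx ^ d * varz ^ e \<in> wspan ?n" if "d + e = ?n" for d e
    using that
  proof (induction d arbitrary: e)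
    case 0
    thus ?case using wvec_in_wspan[of e 0 ?n 0] by (simp add: wvec_def)
  next
    case (Suc d)
    have "poisson varx (varx ^ d * varz ^ Suc e) \<in> wspan ?n"
      using Suc.prems by (intro wspan_adx Suc.IH) simp
    hence 1: "varx ^ d * vary * varz ^ e \<in> wspan ?n" by (rule adx_wspan_cancel)
    show ?case
    proof (cases e)
      \<comment> \<open>Here {x, x^d y} = x^(d+1), without a \<open>Delta\<close> term.\<close>
      case 0
      thus ?thesis using wspan_adx[OF 1]
        by (simp add: adx_varx_power mult.assoc mult.commute[of _ varx])
    next
      case (Suc g)
      have "poisson varx (varx ^ d * vary * varz ^ e) =
         sscale (2 * (real g + 1) + 1) (varx ^ Suc d * varz ^ e) -
         sscale (2 * (real g + 1)) (Delta * (varx ^ d * vary ^ 0 * varz ^ g))"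
        unfolding Suc mult.assoc adx_varx_power adx_vary_varz_power
        by (simp add: right_diff_distrib) (simp add: sscale_def mult_ac)
      moreover have "sscale (2 * (real g + 1)) (Delta * (varx ^ d * vary ^ 0 * varz ^ g)) \<in> wspan ?n"
        using Suc.prems Suc by (intro S.subspace_scale[OF wspan_subspace] IH) simp
      ultimately have "sscale (2 * (real g + 1) + 1) (varx ^ Suc d * varz ^ e) \<in> wspan ?n"
        using S.subspace_add[OF wspan_subspace wspan_adx[OF 1]] by (metis diff_add_cancel)
      thus ?thesis by (rule wspan_cancel[OF less_imp_neq[THEN not_sym], rotated]) (simp add: add_nonneg_pos)
    qed
  qed
  \<comment> \<open>Substituting y^2 = x z - Delta lowers the exponent of y by two.\<close>
  have "varx ^ d * vary ^ b * varz ^ e \<in> wspan ?n" if "d + b + e = ?n" for b d e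
    using that
  proof (induction b arbitrary: d e rule: less_induct)
    case (less b)
    consider "b = 0" | "b = 1" | g where "b = g + 2" by (metis One_nat_def add_2_eq_Suc' not0_implies_Suc)
    thus ?case
    proof cases
      case 1
      thus ?thesis using b0[of d e] less.prems by simp
    next
      case 2
      have "poisson varx (varx ^ d * varz ^ Suc e) \<in> wspan ?n"
        using less.prems 2 by (intro wspan_adx b0) simp
      hence "varx ^ d * vary * varz ^ e \<in> wspan ?n" by (rule adx_wspan_cancel)
      thus ?thesis using 2 by simp
    next
      case 3
      have "varx ^ d * vary ^ b * varz ^ e =
          varx ^ Suc d * vary ^ g * varz ^ Suc e - Delta * (varx ^ d * vary ^ g * varz ^ e)"
        unfolding 3 Delta_def power_add power_Suc by algebra
      thus ?thesis using less.IH[of g "Suc d" "Suc e"] IH[of d g e] less.prems 3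
        by (simp add: S.subspace_diff[OF wspan_subspace])
    qed
  qed
  thus ?case by simp
qed

lemma coeff3_sum: "coeff3 (\<Sum>j\<in>J. F j) a b c = (\<Sum>j\<in>J. coeff3 (F j) a b c)"
  by (simp add: coeff3_def fps_sum_nth)

lemma coeff3_monomial:
  "coeff3 (varx ^ d * vary ^ e * varz ^ g) a b c = (if (d, e, g) = (a, b, c) then 1 else 0)"
  by (auto simp: coeff3_def varx_def vary_def varz_def fps_X_power_mult_right_nth
      fps_const_power fps_X_power_nth)

lemma homog_in_wspan:
  assumes "homog n f"
  shows "f \<in> wspan n"
proof -
  define I where "I = {(a, b, c). a + b + c = n}"
  have "I \<subseteq> {..n} \<times> {..n} \<times> {..n}" by (auto simp: I_def)
  hence [simp]: "finite I" by (rule finite_subset) simp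
  have "f = (\<Sum>(a, b, c)\<in>I. sscale (coeff3 f a b c) (varx ^ a * vary ^ b * varz ^ c))"
  proof (rule series_eqI)
    fix a b c
    have "(\<Sum>(d, e, g)\<in>I. coeff3 f d e g * (if (d, e, g) = (a, b, c) then 1 else 0)) =
        (\<Sum>p\<in>I. if p = (a, b, c) then coeff3 f a b c else 0)"
      by (rule sum.cong) (auto split: if_splits)
    also have "\<dots> = (if (a, b, c) \<in> I then coeff3 f a b c else 0)" by simp
    also have "\<dots> = coeff3 f a b c" using assms by (auto simp: I_def homog_def)
    finally show "coeff3 f a b c =
      coeff3 (\<Sum>(a, b, c)\<in>I. sscale (coeff3 f a b c) (varx ^ a * vary ^ b * varz ^ c)) a b c"
      by (simp only: coeff3_sum coeff3_monomial coeff3_simps case_prod_unfold prod.collapse)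
  qed
  also have "\<dots> \<in> wspan n"
    by (intro S.subspace_sum[OF wspan_subspace])
      (auto simp: I_def intro!: S.subspace_scale[OF wspan_subspace] monomial_in_wspan)
  finally show ?thesis .
qed

section \<open>Homogeneous parts and formal sums\<close>

definition hpart :: "nat \<Rightarrow> series \<Rightarrow> series" where
  "hpart n f = Abs_fps (\<lambda>c. Abs_fps (\<lambda>b. Abs_fps (\<lambda>a. if a + b + c = n then coeff3 f a b c else 0)))"

lemma coeff3_hpart: "coeff3 (hpart n f) a b c = (if a + b + c = n then coeff3 f a b c else 0)"
  by (simp add: hpart_def coeff3_def)

lemma hpart_eq_iff_homog: "hpart n f = f \<longleftrightarrow> homog n f"
proof
  assume "hpart n f = f"
  thus "homog n f" unfolding homog_def by (metis coeff3_hpart)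
next
  assume "homog n f"
  hence "coeff3 f a b c = 0" if "a + b + c \<noteq> n" for a b c
    using that unfolding homog_def by blast
  thus "hpart n f = f" by (intro series_eqI) (simp add: coeff3_hpart)
qed

lemma homog_hpart: "homog n (hpart n f)"
  by (auto simp: homog_def coeff3_hpart split: if_splits)

lemma hpart_add: "hpart n (f + g) = hpart n f + hpart n g"
  and hpart_uminus: "hpart n (- f) = - hpart n f"
  and hpart_sscale: "hpart n (sscale r f) = sscale r (hpart n f)"
  and hpart_zero: "hpart n 0 = 0"
  by (auto intro!: series_eqI simp: coeff3_hpart)

lemma hpart_homog_neq: "homog m f \<Longrightarrow> m \<noteq> n \<Longrightarrow> hpart n f = 0"
  unfolding homog_def by (intro series_eqI) (metis coeff3_hpart coeff3_simps(4))

lemma series_eq_hpartI: "(\<And>n. hpart n f = hpart n g) \<Longrightarrow> f = g"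
  by (intro series_eqI) (metis coeff3_hpart)

lemma coeff3_var_mult:
  "coeff3 (varx * f) a b c = (if a = 0 then 0 else coeff3 f (a - 1) b c)"
  "coeff3 (vary * f) a b c = (if b = 0 then 0 else coeff3 f a (b - 1) c)"
  "coeff3 (varz * f) a b c = (if c = 0 then 0 else coeff3 f a b (c - 1))"
  by (simp_all add: coeff3_def varx_def vary_def varz_def)

text \<open>Bracketing with a coordinate differentiates once and multiplies by a linear form, so it
  preserves degree.\<close>

lemma hpart_poisson:
  assumes "v \<in> {varx, vary, varz}"
  shows "hpart n (poisson v f) = poisson v (hpart n f)"
proof -
  \<comment> \<open>The factor 2 is written with \<open>sscale\<close> so that
    \<open>coeff3_simps\<close> can read off coefficients.\<close>
  have *: "poisson varx f = varx * dy f + sscale 2 (vary * dz f)"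
    "poisson vary f = varz * dz f - varx * dx f"
    "poisson varz f = - sscale 2 (vary * dx f) - varz * dy f" for f
    by (simp_all add: poisson_eq poisson_coords_def sscale_def algebra_simps)
  have "coeff3 (hpart n (poisson varx f)) a b c = coeff3 (poisson varx (hpart n f)) a b c" for a b c
    unfolding * by (cases a; cases b; simp add: coeff3_hpart coeff3_var_mult coeff3_d)
  moreover have "coeff3 (hpart n (poisson vary f)) a b c = coeff3 (poisson vary (hpart n f)) a b c"
    for a b c
    unfolding * by (cases a; cases c; simp add: coeff3_hpart coeff3_var_mult coeff3_d)
  moreover have "coeff3 (hpart n (poisson varz f)) a b c = coeff3 (poisson varz (hpart n f)) a b c"
    for a b c
    unfolding * by (cases b; cases c; simp add: coeff3_hpart coeff3_var_mult coeff3_d)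
  ultimately show ?thesis
    using assms by (auto intro: series_eqI)
qed

lemma hpart_poisson_left:
  assumes "v \<in> {varx, vary, varz}"
  shows "hpart n (poisson f v) = poisson (hpart n f) v"
  unfolding poisson_antisym[of _ v] by (simp add: hpart_uminus hpart_poisson[OF assms])

lemma hpart_formal_sum:
  assumes "\<And>j. j \<in> J \<Longrightarrow> homog (d j) (F j)" "finite {j \<in> J. d j = n}"
  shows "hpart n (formal_sum F J) = (\<Sum>j | j \<in> J \<and> d j = n. F j)"
proof (rule series_eqI)
  fix a b c
  have F0: "d j = a + b + c" if "j \<in> J" "coeff3 (F j) a b c \<noteq> 0" for j
    using assms(1)[OF that(1)] that(2) by (simp add: homog_def)
  show "coeff3 (hpart n (formal_sum F J)) a b c = coeff3 (\<Sum>j | j \<in> J \<and> d j = n. F j) a b c"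
  proof (cases "a + b + c = n")
    case True
    have "coeff3 (formal_sum F J) a b c = (\<Sum>j\<in>{j \<in> J. coeff3 (F j) a b c \<noteq> 0}. coeff3 (F j) a b c)"
      by (simp add: formal_sum_def coeff3_def)
    also have "\<dots> = (\<Sum>j | j \<in> J \<and> d j = n. coeff3 (F j) a b c)"
      using assms(2) F0 True by (intro sum.mono_neutral_left) auto
    finally show ?thesis using True by (simp add: coeff3_hpart coeff3_sum)
  next
    case False
    have "coeff3 (F j) a b c = 0" if "j \<in> J" "d j = n" for j
      using F0[OF that(1)] that(2) False by auto
    thus ?thesis using False by (simp add: coeff3_hpart coeff3_sum)
  qed
qed

text \<open>Both sides are compared degree by degree, where the sums are finite and additivity
  suffices.\<close>

lemma poisson_formal_sum:
  assumes F: "\<And>j. j \<in> J \<Longrightarrow> homog (d j) (F j)" and fin: "\<And>n. finite {j \<in> J. d j = n}"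
    and v: "v \<in> {varx, vary, varz}"
  shows "poisson (formal_sum F J) v = formal_sum (\<lambda>j. poisson (F j) v) J"
proof (rule series_eq_hpartI)
  fix n
  have "homog (d j) (poisson (F j) v)" if "j \<in> J" for j
    using F[OF that] hpart_poisson_left[OF v] by (simp flip: hpart_eq_iff_homog)
  moreover have "poisson (sum F I) v = (\<Sum>j\<in>I. poisson (F j) v)" for I
    by (induction I rule: infinite_finite_induct) (simp_all add: poisson_add_left)
  ultimately show "hpart n (poisson (formal_sum F J) v) = hpart n (formal_sum (\<lambda>j. poisson (F j) v) J)"
    using F fin by (simp add: hpart_poisson_left[OF v] hpart_formal_sum[where d = d])
qed

section \<open>Degreewise description of \<open>b_space\<close>\<close>

definition deg_index :: "nat \<Rightarrow> (int \<times> nat \<times> nat) set" where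
  "deg_index n = {(l, i, k). (l, i, k) \<in> index_set \<and> i + 2 * k + 1 = n}"

lemma finite_deg_index: "finite (deg_index n)"
  unfolding deg_index_def by (rule finite_index_degree)

lemma deg_index_altdef: "deg_index n = {j \<in> index_set. (\<lambda>(l, i, k). i + 2 * k + 1) j = n}"
  by (auto simp: deg_index_def)

lemma homog_b_term:
  "homog ((\<lambda>(l, i, k). i + 2 * k + 1) j) ((\<lambda>(l, i, k). sscale (\<beta> l i k) (b_series l i k)) j)"
  by (cases j) (simp only: prod.case homog_sscale homog_b_series)

lemma hpart_b_sum:
  "hpart n (b_sum c \<beta>) = (if n = 1 then sscale c (b_series 1 0 0) else 0) +
     (\<Sum>(l, i, k)\<in>deg_index n. sscale (\<beta> l i k) (b_series l i k))"
proof -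
  have "homog 1 (b_series 1 0 0)" using homog_b_series[of 0 0 1] by simp
  hence "hpart n (b_series 1 0 0) = (if n = 1 then b_series 1 0 0 else 0)"
    by (simp add: hpart_eq_iff_homog hpart_homog_neq)
  moreover have "hpart n (formal_sum (\<lambda>(l, i, k). sscale (\<beta> l i k) (b_series l i k)) index_set)
    = (\<Sum>(l, i, k)\<in>deg_index n. sscale (\<beta> l i k) (b_series l i k))"
    using finite_deg_index[of n] unfolding deg_index_altdef by (intro hpart_formal_sum homog_b_term)
  ultimately show ?thesis by (simp add: b_sum_def hpart_add hpart_sscale)
qed

text \<open>The components of \<open>ham\<close> are brackets with the coordinates, so
  \<open>ham\<close> passes through formal sums.\<close>

lemma ham_b_sum: "ham (b_sum c \<beta>) = B_sum c \<beta>"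
proof -
  define F where "F = (\<lambda>(l, i, k). sscale (\<beta> l i k) (b_series l i k))"
  have "poisson (formal_sum F index_set) v = formal_sum (\<lambda>j. poisson (F j) v) index_set"
    if "v \<in> {varx, vary, varz}" for v
    using that finite_deg_index unfolding F_def deg_index_altdef
    by (intro poisson_formal_sum[where d = "\<lambda>(l, i, k). i + 2 * k + 1"] homog_b_term)
  hence "ham (formal_sum F index_set) = formal_vsum (\<lambda>j. ham (F j)) index_set"
    by (simp add: ham_def vf_of_def formal_vsum_def)
  moreover have "ham (F j) = (\<lambda>(l, i, k). vscale (\<beta> l i k) (B_field l i k)) j" for j
    by (cases j) (simp add: F_def ham_sscale ham_b_series)
  ultimately show ?thesis
    by (simp add: b_sum_def B_sum_def ham_add ham_sscale ham_b_series F_def)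
qed

lemma kappa_nonzero: "kappa l m \<noteq> 0"
  by (simp add: kappa_def)

lemma b_series_wvec:
  "b_series l i k =
     sscale (- 1 / (real (i + 1) * kappa (nat (l + 1)) (2 * i + 2))) (wvec (nat (l + 1)) (i + 1) k)"
  by (simp add: b_series_def wvec_def)

lemma b_series_100: "b_series 1 0 0 = - varx"
proof -
  have "wvec (nat 2) (0 + 1) 0 = sscale 2 varx"
    by (simp add: wvec_def numeral_2_eq_2 poisson_mult_right sscale_def)
  thus ?thesis by (simp add: b_series_wvec kappa_def)
qed

text \<open>This is zero for n = 1; the linear term of \<open>b_space\<close> is treated
  separately.\<close>

definition bspan :: "nat \<Rightarrow> series set" where
  "bspan n = S.span ((\<lambda>(l, i, k). b_series l i k) ` deg_index n)"

lemma bspan_subspace: "S.subspace (bspan n)"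
  unfolding bspan_def by (rule S.subspace_span)

lemma b_series_in_bspan: "(l, i, k) \<in> deg_index n \<Longrightarrow> b_series l i k \<in> bspan n"
  unfolding bspan_def by (rule S.span_base) force

lemma bspan_explicit:
  assumes "f \<in> bspan n"
  shows "\<exists>\<beta>. f = (\<Sum>(l, i, k)\<in>deg_index n. sscale (\<beta> l i k) (b_series l i k))"
  using assms unfolding bspan_def
proof (induction rule: S.span_induct_alt)
  case base
  show ?case by (intro exI[of _ "\<lambda>_ _ _. 0"]) (simp add: case_prod_unfold)
next
  case (step c x y)
  then obtain l i k \<beta> where x: "(l, i, k) \<in> deg_index n" "x = b_series l i k"
    and y: "y = (\<Sum>(l, i, k)\<in>deg_index n. sscale (\<beta> l i k) (b_series l i k))" by auto
  define \<delta> where "\<delta> l' i' k' = (if (l', i', k') = (l, i, k) then c else 0)" for l' i' k'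
  have "(\<Sum>(l, i, k)\<in>deg_index n. sscale (\<delta> l i k) (b_series l i k)) =
      (\<Sum>j\<in>deg_index n. if j = (l, i, k) then sscale c x else 0)"
    by (rule sum.cong) (auto simp: \<delta>_def x split: if_splits)
  also have "\<dots> = sscale c x" using x finite_deg_index by simp
  finally have "sscale c x + y =
      (\<Sum>(l, i, k)\<in>deg_index n. sscale (\<delta> l i k + \<beta> l i k) (b_series l i k))"
    by (simp add: y S.scale_left_distrib case_prod_unfold sum.distrib)
  thus ?case by (intro exI[of _ "\<lambda>l i k. \<delta> l i k + \<beta> l i k"])
qed

lemma b_space_iff:
  "f \<in> b_space \<longleftrightarrow> (\<exists>c. hpart 1 f = sscale c varx) \<and> (\<forall>n. n \<noteq> 1 \<longrightarrow> hpart n f \<in> bspan n)"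
proof (intro iffI conjI allI impI)
  assume "f \<in> b_space"
  then obtain c \<beta> where f: "f = b_sum c \<beta>" by (auto simp: b_space_def)
  have "deg_index 1 = {}" by (auto simp: deg_index_def index_set_def)
  thus "\<exists>c. hpart 1 f = sscale c varx"
    by (intro exI[of _ "- c"]) (simp add: f hpart_b_sum b_series_100)
  fix n :: nat assume "n \<noteq> 1"
  thus "hpart n f \<in> bspan n" unfolding f hpart_b_sum
    by (auto intro!: S.subspace_sum[OF bspan_subspace] S.subspace_scale[OF bspan_subspace]
        b_series_in_bspan)
next
  assume *: "(\<exists>c. hpart 1 f = sscale c varx) \<and> (\<forall>n. n \<noteq> 1 \<longrightarrow> hpart n f \<in> bspan n)"
  then obtain c where c: "hpart 1 f = sscale c varx" by blast
  have "\<forall>n. \<exists>\<beta>. n \<noteq> 1 \<longrightarrow> hpart n f = (\<Sum>(l, i, k)\<in>deg_index n. sscale (\<beta> l i k) (b_series l i k))"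
    using * bspan_explicit by blast
  from choice[OF this] obtain \<beta> where \<beta>: "\<forall>n. n \<noteq> 1 \<longrightarrow>
      hpart n f = (\<Sum>(l, i, k)\<in>deg_index n. sscale (\<beta> n l i k) (b_series l i k))" ..
  \<comment> \<open>An index determines its degree, so the coefficients chosen in each degree glue
    to one family. The sign comes from \<open>b_series_100\<close>.\<close>
  have "f = b_sum (- c) (\<lambda>l i k. \<beta> (i + 2 * k + 1) l i k)"
  proof (rule series_eq_hpartI)
    fix n
    have "(\<Sum>(l, i, k)\<in>deg_index n. sscale (\<beta> (i + 2 * k + 1) l i k) (b_series l i k)) =
        (\<Sum>(l, i, k)\<in>deg_index n. sscale (\<beta> n l i k) (b_series l i k))"
      by (rule sum.cong) (auto simp: deg_index_def)
    moreover have "deg_index 1 = {}" by (auto simp: deg_index_def index_set_def)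
    ultimately show "hpart n f = hpart n (b_sum (- c) (\<lambda>l i k. \<beta> (i + 2 * k + 1) l i k))"
      using \<beta> c by (simp add: hpart_b_sum b_series_100)
  qed
  thus "f \<in> b_space" by (auto simp: b_space_def)
qed

lemma b_space_subspace: "S.subspace b_space"
proof (rule S.subspaceI)
  show "0 \<in> b_space"
    by (auto simp: b_space_iff hpart_zero S.subspace_0[OF bspan_subspace] intro!: exI[of _ 0])
next
  fix f g assume "f \<in> b_space" "g \<in> b_space"
  thus "f + g \<in> b_space"
    by (auto simp: b_space_iff hpart_add S.subspace_add[OF bspan_subspace] simp flip: S.scale_left_distrib)
next
  fix r f assume "f \<in> b_space"
  thus "sscale r f \<in> b_space"
    by (auto simp: b_space_iff hpart_sscale S.subspace_scale[OF bspan_subspace])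
qed

lemma b_series_in_b_space:
  assumes "(l, i, k) \<in> insert (1, 0, 0) index_set"
  shows "b_series l i k \<in> b_space"
proof (cases "(l, i, k) \<in> index_set")
  case True
  let ?n = "i + 2 * k + 1"
  have "i + 2 * k \<ge> 1" using True by (simp add: index_set_def)
  hence "?n \<noteq> 1" by linarith
  moreover have "b_series l i k \<in> bspan ?n"
    using True by (intro b_series_in_bspan) (simp add: deg_index_def)
  moreover have "hpart n (b_series l i k) = (if n = ?n then b_series l i k else 0)" for n
    using homog_b_series[of i k l] by (auto simp: hpart_eq_iff_homog hpart_homog_neq)
  ultimately show ?thesis
    by (auto simp: b_space_iff S.subspace_0[OF bspan_subspace] intro!: exI[of _ 0])
next
  case False
  have "hpart n varx = (if n = 1 then varx else 0)" for n
    by (simp add: hpart_eq_iff_homog hpart_homog_neq[of 1] del: One_nat_def)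
  thus ?thesis using False assms
    by (auto simp: b_series_100 b_space_iff hpart_uminus S.subspace_0[OF bspan_subspace]
      intro!: exI[of _ "- 1"])
qed

section \<open>The Casimir criterion for \<open>bspan\<close>\<close>

text \<open>Each generator is a multiple of some \<open>wvec j m k\<close> with m = i + 1 between 1
  and n, so one factor of the product kills it.\<close>

lemma casimir_prod_bspan: "f \<in> bspan n \<Longrightarrow> casimir_prod n f = 0"
  unfolding bspan_def
proof (induction rule: S.span_induct_alt)
  case (step c x y)
  then obtain l i k where "x = b_series l i k" "i + 1 \<le> n" by (auto simp: deg_index_def)
  hence "casimir_prod n x = 0"
    by (simp add: b_series_wvec casimir_prod_sscale casimir_prod_wvec del: S.scale_minus_left)
  thus ?case using step by (simp add: casimir_prod_add casimir_prod_sscale)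
qed (rule casimir_prod_0)

text \<open>For odd \<open>n\<close> the power of \<open>Delta\<close> has degree \<open>n - 1\<close>, so homogeneity forces \<open>c = 0\<close>.\<close>

lemma homog_decomp:
  assumes "homog n f" "2 \<le> n"
  shows "\<exists>c. \<exists>g\<in>bspan n. f = sscale c (Delta ^ (n div 2)) + g"
  using homog_in_wspan[OF assms(1)] unfolding wspan_def
proof (induction rule: S.span_induct_alt)
  case base
  show ?case by (intro exI[of _ 0] bexI[of _ 0]) (simp_all add: S.subspace_0[OF bspan_subspace])
next
  case (step c x y)
  then obtain j m k where x: "x = wvec j m k" "m + 2 * k = n" by blast
  obtain c' g where y: "g \<in> bspan n" "y = sscale c' (Delta ^ (n div 2)) + g" using step by blast
  \<comment> \<open>The first case is the power of \<open>Delta\<close> and the second vanishes. The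
    third is a multiple of \<open>b_series l i k\<close> with l = j - 1 and i = m - 1, where j \<le>
    2 m is the bound l \<le> 2 i + 1.\<close>
  consider "m = 0" "j = 0" | "2 * m < j" | i where "m = Suc i" "j \<le> 2 * m"
    by (metis le_zero_eq mult_0_right not0_implies_Suc not_less)
  thus ?case
  proof cases
    case 1
    hence "x = Delta ^ (n div 2)" using x by (auto simp: wvec_def)
    thus ?thesis using y
      by (intro exI[of _ "c + c'"] bexI[of _ g]) (simp_all add: S.scale_left_distrib)
  next
    case 2
    thus ?thesis using x y by (auto simp: wvec_eq_0)
  next
    case 3
    define r where "r = - 1 / (real (i + 1) * kappa (nat (int j - 1 + 1)) (2 * i + 2))"
    have "r \<noteq> 0" by (simp add: r_def kappa_nonzero)
    moreover have "b_series (int j - 1) i k = sscale r x"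
      by (simp add: b_series_wvec r_def x 3)
    ultimately have "x = sscale (1 / r) (b_series (int j - 1) i k)" by simp
    moreover have "(int j - 1, i, k) \<in> deg_index n"
      using x 3 assms(2) by (auto simp: deg_index_def index_set_def)
    hence "b_series (int j - 1) i k \<in> bspan n" by (rule b_series_in_bspan)
    ultimately have "sscale c x + g \<in> bspan n"
      using y by (simp add: S.subspace_add[OF bspan_subspace] S.subspace_scale[OF bspan_subspace])
    thus ?thesis using y by (intro exI[of _ c'] bexI[of _ "sscale c x + g"]) simp_all
  qed
qed

text \<open>\<open>casimir_prod n\<close> commutes with {v, -} and reduces \<open>h\<close> to a
  multiple of a power of \<open>Delta\<close>, which the bracket kills.\<close>

lemma casimir_prod_poisson_eq_0:
  assumes "homog n h" "2 \<le> n" "v \<in> {varx, vary, varz}"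
  shows "casimir_prod n (poisson v h) = 0"
proof -
  obtain c g where "g \<in> bspan n" "h = sscale c (Delta ^ (n div 2)) + g"
    using homog_decomp[OF assms(1,2)] by blast
  moreover obtain r where "casimir_prod n (Delta ^ (n div 2)) = sscale r (Delta ^ (n div 2))"
    using casimir_prod_invariant[of "Delta ^ (n div 2)"] by auto
  ultimately show ?thesis using assms(3)
    by (simp add: casimir_prod_poisson casimir_prod_add casimir_prod_sscale casimir_prod_bspan
        poisson_sscale_right)
qed

lemma Delta_power_nonzero: "Delta ^ q \<noteq> 0"
proof -
  have "coeff3 (varx ^ 1 * vary ^ 0 * varz ^ 1 - varx ^ 0 * vary ^ 2 * varz ^ 0) 1 0 1 = 1"
    unfolding coeff3_simps coeff3_monomial by simp
  hence "Delta \<noteq> 0" by (auto simp: Delta_def)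
  thus ?thesis by simp
qed

text \<open>\<open>casimir_prod n\<close> kills the \<open>bspan\<close> part and scales the
  \<open>Delta\<close> part by a nonzero number, so the latter must be zero.\<close>

lemma homog_in_bspan:
  assumes "homog n f" "2 \<le> n" "casimir_prod n f = 0"
  shows "f \<in> bspan n"
proof -
  obtain c g where g: "g \<in> bspan n" "f = sscale c (Delta ^ (n div 2)) + g"
    using homog_decomp[OF assms(1,2)] by blast
  moreover obtain r where r: "r \<noteq> 0" "casimir_prod n (Delta ^ (n div 2)) = sscale r (Delta ^ (n div 2))"
    using casimir_prod_invariant[of "Delta ^ (n div 2)"] by auto
  ultimately have "sscale (c * r) (Delta ^ (n div 2)) = 0"
    using assms(3) by (simp add: casimir_prod_add casimir_prod_sscale casimir_prod_bspan)
  hence "c = 0" using r Delta_power_nonzero[of "n div 2"] by (metis S.scale_eq_0_iff mult_eq_0_iff)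
  thus ?thesis using g by simp
qed

section \<open>Closure under the Poisson bracket\<close>

lemma poisson_in_b_space:
  assumes "f \<in> b_space" "g \<in> b_space"
  shows "poisson f g \<in> b_space"
  unfolding b_space_iff
proof (intro conjI allI impI)
  \<comment> \<open>The linear part is a multiple of x, so \<open>dy h\<close> and
    \<open>dz h\<close> have no constant term. Every product in the coordinate formula of the
    bracket contains such a factor, hence the bracket has no linear part.\<close>
  have "coeff3 h 0 1 0 = 0 \<and> coeff3 h 0 0 1 = 0" if h: "h \<in> b_space" for h
  proof -
    obtain c where c: "hpart 1 h = sscale c varx" using h unfolding b_space_iff by blast
    show ?thesis
      using coeff3_hpart[of 1 h 0 1 0] coeff3_hpart[of 1 h 0 0 1] by (simp add: c coeff3_vars del: One_nat_def)
  qed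
  hence 0: "coeff3 (dy h) 0 0 0 = 0" "coeff3 (dz h) 0 0 0 = 0" if "h \<in> b_space" for h
    using that by (simp_all add: coeff3_d)
  have "poisson f g = varx * (dx f * dy g - dy f * dx g) + sscale 2 (vary * (dx f * dz g - dz f * dx g))
      + varz * (dy f * dz g - dz f * dy g)"
    by (simp add: poisson_eq poisson_coords_def sscale_def)
  moreover have "coeff3 (p * q) 0 0 0 = coeff3 p 0 0 0 * coeff3 q 0 0 0" for p q
    by (simp add: coeff3_def)
  ultimately have coeffs: "coeff3 (poisson f g) 1 0 0 = 0" "coeff3 (poisson f g) 0 1 0 = 0"
    "coeff3 (poisson f g) 0 0 1 = 0"
    using 0[OF assms(1)] 0[OF assms(2)] by (simp_all add: coeff3_var_mult)
  have "coeff3 (poisson f g) a b c = 0" if "a + b + c = 1" for a b c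
  proof -
    from that have "(a, b, c) \<in> {(1, 0, 0), (0, 1, 0), (0, 0, 1)}" by auto
    thus ?thesis using coeffs by auto
  qed
  hence "hpart 1 (poisson f g) = sscale 0 varx"
    by (intro series_eqI) (simp add: coeff3_hpart)
  thus "\<exists>c. hpart 1 (poisson f g) = sscale c varx" by blast
next
  fix n :: nat assume n: "n \<noteq> 1"
  \<comment> \<open>Each degree becomes a sum of brackets with coordinates. In degree 0 these are
    brackets with constants; in degree at least 2 \<open>casimir_prod n\<close> kills each of
    them.\<close>
  have eq: "hpart n (poisson f g) = poisson varx (hpart n (dx f * g)) +
      poisson vary (hpart n (dy f * g)) + poisson varz (hpart n (dz f * g))"
    by (subst poisson_divergence_form) (simp add: hpart_add hpart_poisson)
  show "hpart n (poisson f g) \<in> bspan n"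
  proof (cases "n = 0")
    case True
    have "hpart 0 h = const3 (coeff3 h 0 0 0)" for h
      by (rule series_eqI) (simp add: coeff3_hpart)
    thus ?thesis using eq True by (simp add: S.subspace_0[OF bspan_subspace])
  next
    case False
    thus ?thesis using n
      by (intro homog_in_bspan homog_hpart)
        (simp_all add: eq casimir_prod_add casimir_prod_poisson_eq_0 homog_hpart)
  qed
qed

section \<open>Injectivity of \<open>ham\<close>\<close>

text \<open>Every homogeneous part of \<open>f\<close> is invariant. In degree 1, {y, x} = -x
  excludes multiples of x; in other degrees \<open>casimir_prod n\<close> is zero on
  \<open>bspan\<close> but a nonzero scalar on invariants.\<close>

lemma ham_eq_0:
  assumes "f \<in> b_space" "ham f = 0"
  shows "f = 0"
proof -
  have "poisson v f = 0" if "v \<in> {varx, vary, varz}" for v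
  proof -
    have "poisson f v = 0" using that assms(2) by (auto simp: ham_def vf_of_def zero_prod_def)
    thus ?thesis by (subst poisson_antisym) simp
  qed
  hence *: "poisson v (hpart n f) = 0" if "v \<in> {varx, vary, varz}" for v n
    using that by (simp only: hpart_poisson[OF that, symmetric] hpart_zero)
  have inv: "poisson varx (hpart n f) = 0" "poisson vary (hpart n f) = 0" "poisson varz (hpart n f) = 0"
    for n
    by (rule *, simp)+
  have "hpart n f = 0" for n
  proof (cases "n = 1")
    case True
    obtain c where "hpart 1 f = sscale c varx" using assms(1) by (auto simp: b_space_iff)
    thus ?thesis using inv(2)[of 1] True by (simp add: poisson_sscale_right)
  next
    case False
    obtain r where "r \<noteq> 0" "casimir_prod n (hpart n f) = sscale r (hpart n f)"
      using casimir_prod_invariant[OF inv, of n n] by blast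
    moreover have "casimir_prod n (hpart n f) = 0"
      using False assms(1) by (simp add: b_space_iff casimir_prod_bspan)
    ultimately show ?thesis by simp
  qed
  thus ?thesis using series_eq_hpartI[of f 0] by (simp add: hpart_zero)
qed

lemma inj_on_ham: "inj_on ham b_space"
proof (rule inj_onI)
  fix f g assume fg: "f \<in> b_space" "g \<in> b_space" "ham f = ham g"
  have "ham (f - g) + ham g = ham f" by (simp flip: ham_add)
  hence "ham (f - g) = 0" using fg by simp
  thus "f = g" using ham_eq_0 S.subspace_diff[OF b_space_subspace fg(1,2)] by fastforce
qed

section \<open>The Lie isomorphism\<close>

text \<open>Carries closure and the Jacobi identity from \<open>b_space\<close> over to
  \<open>B_space\<close> along \<open>ham\<close>.\<close>

lemma lie_algebra_image:
  assumes "lie_algebra_on scale V br" "vector_space scale'"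
    and "\<And>u v. \<phi> (u + v) = \<phi> u + \<phi> v" "\<And>r u. \<phi> (scale r u) = scale' r (\<phi> u)"
    and "\<And>u v. br' (\<phi> u) (\<phi> v) = \<phi> (br u v)"
  shows "lie_algebra_on scale' (\<phi> ` V) br'"
proof -
  interpret V: vector_space scale using assms(1) by (simp add: lie_algebra_on_def)
  interpret W: vector_space scale' by fact
  have "\<phi> 0 = 0" using assms(3)[of 0 0] by simp
  moreover have "W.subspace (\<phi> ` V)"
  proof -
    interpret Vector_Spaces.linear scale scale' \<phi> by unfold_locales (rule assms)+
    show ?thesis using assms(1) by (intro subspace_image) (simp add: lie_algebra_on_def)
  qed
  ultimately show ?thesis
    using assms(1) unfolding lie_algebra_on_def
    by (auto simp: assms(5) W.vector_space_axioms simp flip: assms(3,4))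
qed

lemma lie_algebra_b_space: "lie_algebra_on sscale b_space poisson"
proof -
  have "poisson f (poisson g h) + poisson g (poisson h f) + poisson h (poisson f g) = 0" for f g h
    using poisson_jacobi[of f g h] poisson_antisym[of h f] poisson_antisym[of h "poisson f g"]
    by (simp add: poisson_uminus_right)
  thus ?thesis
    by (simp add: lie_algebra_on_def vector_space_sscale b_space_subspace poisson_in_b_space
        poisson_add_left poisson_add_right poisson_sscale_left poisson_sscale_right)
qed

text \<open>\<open>B_sum c \<beta>\<close> is \<open>ham\<close> of the series
  \<open>b_sum c \<beta>\<close>, so it depends on that series alone; this is the uniqueness
  required by \<open>THE\<close>.\<close>

lemma Psi_b_sum: "Psi (b_sum c \<beta>) = B_sum c \<beta>"
  unfolding Psi_def by (rule the_equality) (blast, metis ham_b_sum)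

lemma Psi_eq_ham: "f \<in> b_space \<Longrightarrow> Psi f = ham f"
  unfolding b_space_def by (auto simp: Psi_b_sum ham_b_sum)

lemma B_space_eq: "B_space = ham ` b_space"
  unfolding B_space_def b_space_def ham_b_sum[symmetric] by blast

theorem lemma3p2:
  shows "(\<forall>f\<in>b_space. \<forall>g\<in>b_space. poisson f g \<in> b_space) \<and>
    (\<forall>c \<beta>. Psi (b_sum c \<beta>) = B_sum c \<beta>) \<and>
    (\<forall>(l, i, k)\<in>insert (1, 0, 0) index_set. Psi (b_series l i k) = B_field l i k) \<and>
    lie_isomorphism sscale b_space poisson vscale B_space lie_bracket Psi"
proof (intro conjI)
  show "\<forall>f\<in>b_space. \<forall>g\<in>b_space. poisson f g \<in> b_space"
    by (simp add: poisson_in_b_space)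
  show "\<forall>c \<beta>. Psi (b_sum c \<beta>) = B_sum c \<beta>"
    by (simp add: Psi_b_sum)
  show "\<forall>(l, i, k)\<in>insert (1, 0, 0) index_set. Psi (b_series l i k) = B_field l i k"
    using b_series_in_b_space by (auto simp: Psi_eq_ham ham_b_series)
  have "lie_algebra_on vscale B_space lie_bracket"
    unfolding B_space_eq
    by (rule lie_algebra_image[OF lie_algebra_b_space vector_space_vscale])
      (simp_all add: ham_add ham_sscale lie_bracket_ham)
  moreover have "bij_betw Psi b_space B_space"
    using inj_on_ham Psi_eq_ham by (auto simp: bij_betw_def B_space_eq inj_on_def)
  ultimately show "lie_isomorphism sscale b_space poisson vscale B_space lie_bracket Psi"
    using S.subspace_add[OF b_space_subspace] S.subspace_scale[OF b_space_subspace]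
    by (simp add: lie_isomorphism_def lie_algebra_b_space Psi_eq_ham poisson_in_b_space
        ham_add ham_sscale lie_bracket_ham)
qed

end
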